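(* Suppose that $\log x=\tau\sqrt{\log q\,\log\log q}$ with $\tau=(\log\log q)^{O(1)}$ (that is, $|\log\tau|\ll\log\log\log q$), and let $\eta=\tau+1/\tau$. There exists a constant $c>0$ such that for any sufficiently large $q$ there exists a non-principal character $\chi \pmod q$ for which $$\frac{1}{\sqrt{x}}\left|\sum_{n\le x}\chi(n)\right|\gg \exp\left(c\,\frac{1+\log(\eta\tau)}{\eta}\sqrt{\frac{\log q}{\log\log q}}\right).$$
   Context: $\chi$ is a Dirichlet character modulo the positive integer $q$. *)

theory Defs
  imports Complex_Main
begin

text \<open>A Dirichlet character modulo \<open>q\<close> is a homomorphism from the units modulo \<open>q\<close> to the nonzero
  complex numbers, viewed as a \<open>q\<close>-periodic function on the integers that vanishes off the
  integers coprime to \<open>q\<close>.\<close>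

definition dirichlet_character :: "nat \<Rightarrow> (int \<Rightarrow> complex) \<Rightarrow> bool" where
  "dirichlet_character q \<chi> \<longleftrightarrow>
     q > 0 \<and>
     (\<forall>m n. \<chi> (m * n) = \<chi> m * \<chi> n) \<and>
     (\<forall>n. \<chi> (n + int q) = \<chi> n) \<and>
     (\<forall>n. \<chi> n \<noteq> 0 \<longleftrightarrow> coprime n (int q))"

definition principal_character :: "nat \<Rightarrow> int \<Rightarrow> complex" where
  "principal_character q n = (if coprime n (int q) then 1 else 0)"

end

theory Submission
  imports Defs "HOL-Number_Theory.Number_Theory" "HOL-Library.FuncSet" "HOL-Library.Disjoint_Sets"
    "HOL-Real_Asymp.Real_Asymp"
begin

text \<open>Write \<open>L = ln q\<close> and \<open>l = ln L\<close>. By the pigeonhole principle, there is a set \<open>K\<close> of more than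
  \<open>sqrt q\<close> characters modulo \<open>q\<close> such that \<open>\<chi>(p) / \<psi>(p)\<close> has real part at least \<open>3 / 4\<close> for all
  \<open>\<chi>, \<psi> \<in> K\<close> and for about \<open>L / 25\<close> primes \<open>p \<le> 25 L l\<close>. The mean of \<open>|\<Sum>n\<le>x. \<chi>(n) / \<psi>(n)|\<^sup>2\<close>
  over \<open>K \<times> K\<close> is a sum of squares \<open>|\<Sum>\<chi>\<in>K. \<chi>(n) / \<chi>(m)|\<^sup>2\<close> over \<open>n, m \<le> x\<close>; keeping only
  \<open>n = b a\<close>, \<open>m = b a'\<close> with \<open>a, a'\<close> products of \<open>r\<close> of these primes, and resumming, each of
  the \<open>r\<close> primes gains a constant factor over the trivial size \<open>x\<close>. One can take \<open>r\<close> of order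
  \<open>min 1 \<tau> * sqrt (L / l)\<close>, which is at least the exponent claimed because
  \<open>(1 + ln (\<eta> \<tau>)) / \<eta> \<le> 2 min 1 \<tau>\<close>. The diagonal, which carries the principal character, is
  negligible since \<open>x\<close> is smaller than any power of \<open>q\<close>.\<close>

section \<open>The number of Dirichlet characters\<close>

text \<open>Subgroups of the units modulo \<open>q\<close> are represented by \<open>q\<close>-periodic sets of integers, and
  their characters by \<open>q\<close>-periodic functions that vanish off the subgroup.\<close>

definition unit_subgroup :: "nat \<Rightarrow> int set \<Rightarrow> bool" where
  "unit_subgroup q H \<longleftrightarrow> 1 \<in> H \<and> (\<forall>m\<in>H. \<forall>n\<in>H. m * n \<in> H) \<and>
     (\<forall>n\<in>H. coprime n (int q)) \<and> (\<forall>m n. [m = n] (mod int q) \<longrightarrow> m \<in> H \<longrightarrow> n \<in> H)"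

definition partial_character :: "nat \<Rightarrow> int set \<Rightarrow> (int \<Rightarrow> complex) \<Rightarrow> bool" where
  "partial_character q H f \<longleftrightarrow> (\<forall>m\<in>H. \<forall>n\<in>H. f (m * n) = f m * f n) \<and> f 1 = 1 \<and>
     (\<forall>m n. [m = n] (mod int q) \<longrightarrow> f m = f n) \<and> (\<forall>n. n \<notin> H \<longrightarrow> f n = 0)"

lemma euler_theorem_int:
  assumes "q > 0" "coprime n (int q)"
  shows "[n ^ totient q = 1] (mod int q)"
proof -
  have "coprime (nat (n mod int q)) q"
    using assms by (metis coprime_int_iff coprime_mod_left_iff int_nat_eq of_nat_0_less_iff
      pos_mod_sign less_irrefl)
  from euler_theorem[OF this] have "[int (nat (n mod int q)) ^ totient q = 1] (mod int q)"
    by (metis cong_int_iff of_nat_1 of_nat_power)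
  then have "[(n mod int q) ^ totient q = 1] (mod int q)"
    using assms by simp
  then show ?thesis
    by (simp add: Cong.cong_def power_mod)
qed

lemma unit_subgroup_power:
  "unit_subgroup q H \<Longrightarrow> n \<in> H \<Longrightarrow> n ^ i \<in> H"
  by (induction i) (auto simp: unit_subgroup_def)

text \<open>By Euler's theorem the inverse of \<open>n\<close> modulo \<open>q\<close> is the power
  \<open>n ^ (totient q - 1)\<close>, so closure under products already gives inverses.\<close>

lemma unit_subgroup_cancel:
  assumes "q > 0" "unit_subgroup q H" "n \<in> H" "n * m \<in> H"
  shows "m \<in> H"
proof -
  have cop: "coprime n (int q)" using assms by (auto simp: unit_subgroup_def)
  have tot: "totient q > 0" using assms by simp
  have "n ^ (totient q - 1) * (n * m) \<in> H"
    using unit_subgroup_power[OF assms(2,3)] assms by (auto simp: unit_subgroup_def)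
  moreover have "n ^ (totient q - 1) * (n * m) = n ^ totient q * m"
    using tot by (metis mult.assoc power_minus_mult)
  moreover have "[n ^ totient q * m = 1 * m] (mod int q)"
    by (intro cong_mult euler_theorem_int assms cop cong_refl)
  ultimately show ?thesis
    using assms(2) unfolding unit_subgroup_def by (metis mult_1)
qed

lemma partial_character_power:
  assumes "unit_subgroup q H" "partial_character q H f" "n \<in> H"
  shows "f (n ^ i) = f n ^ i"
proof (induction i)
  case (Suc i)
  then show ?case using assms unit_subgroup_power[OF assms(1,3), of i]
    by (simp add: partial_character_def)
qed (use assms in \<open>simp add: partial_character_def\<close>)

lemma partial_character_nonzero:
  assumes "q > 0" "unit_subgroup q H" "partial_character q H f" "n \<in> H"
  shows "f n \<noteq> 0"
proof
  assume "f n = 0"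
  moreover have "f (n ^ totient q) = f 1"
    using assms euler_theorem_int[of q n] by (auto simp: partial_character_def unit_subgroup_def)
  moreover have "totient q > 0" using assms by simp
  ultimately show False
    using partial_character_power[OF assms(2-4)] assms(3)
    by (simp add: partial_character_def power_0_left)
qed

text \<open>If \<open>k\<close> is the order of \<open>g\<close> modulo \<open>H\<close>, then a character \<open>f\<close> of \<open>H\<close> extends to the
  subgroup generated by \<open>H\<close> and \<open>g\<close> by \<open>n \<mapsto> f (n g\<^sup>i) / w\<^sup>i\<close> whenever \<open>n g\<^sup>i \<in> H\<close>, for each of the
  \<open>k\<close> roots \<open>w\<close> of \<open>w\<^sup>k = f (g\<^sup>k)\<close>.\<close>

lemma partial_character_extension:
  assumes q: "q > 0" and H: "unit_subgroup q H" and g: "coprime g (int q)" "g \<notin> H"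
    and F: "finite F" "\<And>f. f \<in> F \<Longrightarrow> partial_character q H f"
           "card F \<ge> card (H \<inter> {0..<int q})"
  shows "\<exists>H' F'. unit_subgroup q H' \<and> H \<subseteq> H' \<and> g \<in> H' \<and> finite F' \<and>
     (\<forall>f\<in>F'. partial_character q H' f) \<and> card F' \<ge> card (H' \<inter> {0..<int q})"
proof -
  have one: "1 \<in> H" and mult: "\<And>m n. m \<in> H \<Longrightarrow> n \<in> H \<Longrightarrow> m * n \<in> H"
    and cop: "\<And>n. n \<in> H \<Longrightarrow> coprime n (int q)"
    and cong: "\<And>m n. [m = n] (mod int q) \<Longrightarrow> m \<in> H \<Longrightarrow> n \<in> H"
    using H unfolding unit_subgroup_def by blast+
  note cancel = unit_subgroup_cancel[OF q H]
  define k where "k = (LEAST k. k > 0 \<and> g ^ k \<in> H)"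
  have "totient q > 0 \<and> g ^ totient q \<in> H"
    using q g euler_theorem_int[OF q g(1)] cong[OF cong_sym one] by auto
  then have "k > 0 \<and> g ^ k \<in> H"
    unfolding k_def by (rule LeastI)
  then have k: "k > 0" and gk: "g ^ k \<in> H" by auto
  have k_dvd: "k dvd t" if "g ^ t \<in> H" for t
  proof -
    have "g ^ t = (g ^ k) ^ (t div k) * g ^ (t mod k)"
      by (simp flip: power_mult power_add)
    then have "g ^ (t mod k) \<in> H"
      using that cancel[OF unit_subgroup_power[OF H gk]] by metis
    then have "\<not> t mod k > 0"
      using k not_less_Least[of "t mod k" "\<lambda>k. k > 0 \<and> g ^ k \<in> H"]
      unfolding k_def[symmetric] by simp
    then show ?thesis by (simp add: mod_eq_0_iff_dvd)
  qed
  define H' where "H' = {n. coprime n (int q) \<and> (\<exists>i. n * g ^ i \<in> H)}"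
  have H'I: "n \<in> H'" if "n * g ^ i \<in> H" for n i
    using cop[OF that] that by (auto simp: H'_def)
  have sub: "H \<subseteq> H'"
    using H'I[of _ 0] by auto
  have gH': "g \<in> H'"
    using gk k by (intro H'I[of _ "k - 1"]) (simp add: power_eq_if)
  have H': "unit_subgroup q H'"
    unfolding unit_subgroup_def
  proof (intro conjI ballI allI impI)
    show "1 \<in> H'" using sub one by blast
    show "coprime n (int q)" if "n \<in> H'" for n using that by (auto simp: H'_def)
    show "m * n \<in> H'" if mn: "m \<in> H'" "n \<in> H'" for m n
    proof -
      obtain i j where ij: "m * g ^ i \<in> H" "n * g ^ j \<in> H"
        using mn by (auto simp: H'_def)
      show ?thesis
        using mult[OF ij] by (intro H'I[of _ "i + j"]) (simp add: power_add mult_ac)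
    qed
    show "n \<in> H'" if mn: "[m = n] (mod int q)" "m \<in> H'" for m n
    proof -
      obtain i where i: "m * g ^ i \<in> H" using mn by (auto simp: H'_def)
      show ?thesis
        using cong[OF cong_scalar_right[OF mn(1)] i] by (rule H'I)
    qed
  qed
  have low: "\<exists>i<k. n * g ^ i \<in> H" if nH': "n \<in> H'" for n
  proof -
    obtain i where i: "n * g ^ i \<in> H" using nH' by (auto simp: H'_def)
    have "n * g ^ i = (g ^ k) ^ (i div k) * (n * g ^ (i mod k))"
      by (simp flip: power_mult power_add add: mult.left_commute)
    then have "n * g ^ (i mod k) \<in> H"
      using i cancel[OF unit_subgroup_power[OF H gk]] by metis
    then show ?thesis using k by (intro exI[of _ "i mod k"]) auto
  qed
  \<comment> \<open>The sets of \<open>n\<close> with \<open>n * g ^ i \<in> H\<close>, for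
    \<open>i < k\<close>, cover \<open>H'\<close>, and multiplication by the unit
    \<open>g ^ i\<close> embeds each of them into the residues of \<open>H\<close>.\<close>
  have card_H': "card (H' \<inter> {0..<int q}) \<le> k * card (H \<inter> {0..<int q})"
  proof -
    have fin: "finite {n \<in> {0..<int q}. n * g ^ i \<in> H}" for i
      by (rule finite_subset[of _ "{0..<int q}"]) auto
    have "H' \<inter> {0..<int q} \<subseteq> (\<Union>i<k. {n \<in> {0..<int q}. n * g ^ i \<in> H})"
      using low by blast
    then have "card (H' \<inter> {0..<int q}) \<le> card (\<Union>i<k. {n \<in> {0..<int q}. n * g ^ i \<in> H})"
      using fin by (intro card_mono) auto
    also have "\<dots> \<le> (\<Sum>i<k. card {n \<in> {0..<int q}. n * g ^ i \<in> H})"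
      by (intro card_UN_le) auto
    also have "\<dots> \<le> (\<Sum>i<k. card (H \<inter> {0..<int q}))"
    proof (intro sum_mono card_inj_on_le)
      fix i
      let ?h = "\<lambda>n. (n * g ^ i) mod int q"
      show "inj_on ?h {n \<in> {0..<int q}. n * g ^ i \<in> H}"
      proof (intro inj_onI)
        fix a b assume ab: "a \<in> {n \<in> {0..<int q}. n * g ^ i \<in> H}"
          "b \<in> {n \<in> {0..<int q}. n * g ^ i \<in> H}" "?h a = ?h b"
        have "[a = b] (mod int q)"
          using ab(3) g(1) cong_mult_rcancel[of "g ^ i" "int q" a b] by (simp add: Cong.cong_def)
        then show "a = b"
          using ab cong_less_imp_eq_int[of a "int q" b] by auto
      qed
      show "?h ` {n \<in> {0..<int q}. n * g ^ i \<in> H} \<subseteq> H \<inter> {0..<int q}"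
        using q cong[of "_ * g ^ i"] by (auto simp: Cong.cong_def)
    qed auto
    finally show ?thesis by simp
  qed
  define ext where "ext = (\<lambda>(f :: int \<Rightarrow> complex, w :: complex) n.
    if n \<in> H' then (let i = SOME i. n * g ^ i \<in> H in f (n * g ^ i) / w ^ i) else 0)"
  \<comment> \<open>The value does not depend on the exponent picked by \<open>SOME\<close>: two
    admissible exponents differ by a multiple of \<open>k\<close>, and
    \<open>w ^ k = f (g ^ k)\<close> makes numerator and denominator change by the same
    factor.\<close>
  have ext_eq: "ext (f, w) n = f (n * g ^ i) / w ^ i"
    if f: "partial_character q H f" and w: "w ^ k = f (g ^ k)" and i: "n * g ^ i \<in> H"
    for f w n i
  proof -
    have fm: "\<And>m n. m \<in> H \<Longrightarrow> n \<in> H \<Longrightarrow> f (m * n) = f m * f n"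
      using f by (auto simp: partial_character_def)
    have w0: "w \<noteq> 0"
      using w partial_character_nonzero[OF q H f gk] k by (auto simp: power_0_left)
    have le: "f (n * g ^ i) / w ^ i = f (n * g ^ j) / w ^ j"
      if ij: "n * g ^ i \<in> H" "n * g ^ j \<in> H" "i \<le> j" for i j
    proof -
      have e: "n * g ^ j = n * g ^ i * g ^ (j - i)"
        using ij by (simp add: mult.assoc flip: power_add)
      then have gji: "g ^ (j - i) \<in> H" using ij cancel by metis
      then obtain t where t: "j - i = k * t" using k_dvd by (auto elim: dvdE)
      have "f (g ^ (j - i)) = w ^ (j - i)"
        using partial_character_power[OF H f gk, of t] w t by (simp add: power_mult)
      then have "f (n * g ^ j) = f (n * g ^ i) * w ^ (j - i)"
        using fm[OF ij(1) gji] by (simp only: e)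
      moreover have "w ^ j = w ^ i * w ^ (j - i)" using ij by (simp flip: power_add)
      ultimately show ?thesis using w0 by simp
    qed
    define i0 where "i0 = (SOME i. n * g ^ i \<in> H)"
    have i0: "n * g ^ i0 \<in> H" unfolding i0_def using i by (rule someI)
    have "ext (f, w) n = f (n * g ^ i0) / w ^ i0"
      using H'I[OF i] by (simp add: ext_def i0_def Let_def)
    also have "\<dots> = f (n * g ^ i) / w ^ i"
      using le[OF i0 i] le[OF i i0] by (metis nat_le_linear)
    finally show ?thesis .
  qed
  have ext_char: "partial_character q H' (ext (f, w))"
    if f: "partial_character q H f" and w: "w ^ k = f (g ^ k)" for f w
    unfolding partial_character_def
  proof (intro conjI ballI allI impI)
    show "ext (f, w) (m * n) = ext (f, w) m * ext (f, w) n" if mn: "m \<in> H'" "n \<in> H'" for m n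
    proof -
      obtain i j where ij: "m * g ^ i \<in> H" "n * g ^ j \<in> H"
        using mn by (auto simp: H'_def)
      have eq: "m * n * g ^ (i + j) = (m * g ^ i) * (n * g ^ j)"
        by (simp add: power_add mult_ac)
      have "ext (f, w) (m * n) = f (m * n * g ^ (i + j)) / w ^ (i + j)"
        using mult[OF ij] by (intro ext_eq f w) (simp add: eq)
      also have "f (m * n * g ^ (i + j)) = f (m * g ^ i) * f (n * g ^ j)"
        using f ij unfolding eq partial_character_def by blast
      finally show ?thesis
        using ext_eq[OF f w ij(1)] ext_eq[OF f w ij(2)] by (simp add: power_add)
    qed
    show "ext (f, w) 1 = 1"
      using ext_eq[OF f w, of 1 0] one f by (simp add: partial_character_def)
    show "ext (f, w) m = ext (f, w) n" if mn: "[m = n] (mod int q)" for m n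
    proof (cases "m \<in> H'")
      case True
      then obtain i where i: "m * g ^ i \<in> H" by (auto simp: H'_def)
      have c: "[m * g ^ i = n * g ^ i] (mod int q)" using mn by (rule cong_scalar_right)
      have "f (m * g ^ i) = f (n * g ^ i)" using f c by (auto simp: partial_character_def)
      then show ?thesis
        using ext_eq[OF f w i] ext_eq[OF f w cong[OF c i]] by simp
    next
      case False
      then have "n \<notin> H'" using H' mn cong_sym unfolding unit_subgroup_def by blast
      with False show ?thesis by (simp add: ext_def)
    qed
    show "ext (f, w) n = 0" if "n \<notin> H'" for n using that by (simp add: ext_def)
  qed
  define D where "D = Sigma F (\<lambda>f. {w :: complex. w ^ k = f (g ^ k)})"
  have finD: "finite D" unfolding D_def using F k by auto
  have cardD: "card D = k * card F"
  proof -
    have "card D = (\<Sum>f\<in>F. card {w :: complex. w ^ k = f (g ^ k)})"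
      unfolding D_def using F k by (intro card_SigmaI) auto
    also have "\<dots> = (\<Sum>f\<in>F. k)"
      using partial_character_nonzero[OF q H F(2) gk] k by (intro sum.cong card_nth_roots) auto
    finally show ?thesis by simp
  qed
  \<comment> \<open>An extension determines its data: exponent \<open>0\<close> recovers
    \<open>f\<close> on \<open>H\<close>, and exponent \<open>k - 1\<close> gives the value
    \<open>f (g ^ k) / w ^ (k - 1) = w\<close> at \<open>g\<close>.\<close>
  have inj: "inj_on ext D"
  proof (intro inj_onI)
    fix x y assume xy: "x \<in> D" "y \<in> D" "ext x = ext y"
    obtain f w f' w' where x: "x = (f, w)" and y: "y = (f', w')" by fastforce
    have f: "partial_character q H f" "w ^ k = f (g ^ k)"
      and f': "partial_character q H f'" "w' ^ k = f' (g ^ k)"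
      using xy F x y by (auto simp: D_def)
    have "f n = f' n" for n
    proof (cases "n \<in> H")
      case True
      then show ?thesis
        using ext_eq[OF f, of n 0] ext_eq[OF f', of n 0] xy(3) x y by simp
    next
      case False
      then show ?thesis using f f' by (simp add: partial_character_def)
    qed
    moreover have "w = w'"
    proof -
      have e: "g * g ^ (k - 1) = g ^ k" using k by (simp add: power_eq_if)
      have gi: "g * g ^ (k - 1) \<in> H" using gk e by simp
      have "ext (f, w) g = w" if "partial_character q H f" "w ^ k = f (g ^ k)" for f w
      proof -
        have "w \<noteq> 0"
          using that partial_character_nonzero[OF q H that(1) gk] k by (auto simp: power_0_left)
        moreover have "ext (f, w) g = w ^ k / w ^ (k - 1)"
          using ext_eq[OF that gi] e that by simp
        moreover have "w ^ k = w * w ^ (k - 1)" using k by (simp add: power_eq_if)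
        ultimately show ?thesis by simp
      qed
      from this[OF f] this[OF f'] show ?thesis using xy(3) x y by simp
    qed
    ultimately show "x = y" using x y by auto
  qed
  have "card (H' \<inter> {0..<int q}) \<le> k * card F"
    using card_H' F(3) by (meson le_trans mult_le_mono2)
  also have "\<dots> = card (ext ` D)" using card_image[OF inj] cardD by simp
  finally have "card (H' \<inter> {0..<int q}) \<le> card (ext ` D)" .
  moreover have "\<forall>f\<in>ext ` D. partial_character q H' f"
    using ext_char F by (auto simp: D_def)
  ultimately show ?thesis using H' sub gH' finD by blast
qed

text \<open>Starting from the trivial character of the class of 1, one unit after another is
  adjoined until the subgroup is the whole unit group. The invariant is that there are at least as
  many characters as residue classes in the subgroup.\<close>

lemma dirichlet_characters_card_ge:
  assumes q: "q > 0"
  shows "\<exists>F. finite F \<and> (\<forall>\<chi>\<in>F. dirichlet_character q \<chi>) \<and> card F \<ge> totient q"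
proof -
  define U where "U = {n. coprime n (int q)}"
  define R where "R = {0..<int q}"
  have step: "\<exists>F. finite F \<and> (\<forall>\<chi>\<in>F. partial_character q U \<chi>) \<and> card F \<ge> card (U \<inter> R)"
    if "unit_subgroup q H" "finite F" "\<forall>f\<in>F. partial_character q H f" "card F \<ge> card (H \<inter> R)"
    for H F
    using that
  proof (induction "card ((U - H) \<inter> R)" arbitrary: H F rule: less_induct)
    case less
    have HU: "H \<subseteq> U" using less.prems by (auto simp: unit_subgroup_def U_def)
    show ?case
    proof (cases "H = U")
      case True
      then show ?thesis using less.prems by blast
    next
      case False
      then obtain g0 where g0: "g0 \<in> U" "g0 \<notin> H" using HU by blast
      \<comment> \<open>Reducing modulo \<open>q\<close> puts the new element into \<open>R\<close>,
        so that adjoining it decreases the induction measure.\<close>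
      define g where "g = g0 mod int q"
      have gc: "[g0 = g] (mod int q)" by (simp add: g_def Cong.cong_def)
      have g: "coprime g (int q)" "g \<notin> H" "g \<in> R"
      proof -
        show "coprime g (int q)"
          using g0 q by (metis U_def cong_imp_coprime gc mem_Collect_eq)
        show "g \<notin> H"
          using g0 gc less.prems(1) cong_sym unfolding unit_subgroup_def by blast
        show "g \<in> R" using q by (simp add: g_def R_def)
      qed
      obtain H' F' where H': "unit_subgroup q H'" "H \<subseteq> H'" "g \<in> H'" "finite F'"
        "\<forall>f\<in>F'. partial_character q H' f" "card F' \<ge> card (H' \<inter> R)"
        using partial_character_extension[OF q less.prems(1) g(1,2) less.prems(2)] less.prems
        unfolding R_def by blast
      have "card ((U - H') \<inter> R) < card ((U - H) \<inter> R)"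
        using H' g by (intro psubset_card_mono) (auto simp: R_def U_def)
      from less.hyps[OF this] H' show ?thesis by blast
    qed
  qed
  define T where "T = {n. [n = 1] (mod int q)}"
  have one: "1 \<in> T" and mult: "\<And>m n. m \<in> T \<Longrightarrow> n \<in> T \<Longrightarrow> m * n \<in> T"
    using cong_mult[of _ 1 "int q" _ 1] by (auto simp: T_def)
  have cong: "n \<in> T" if "[m = n] (mod int q)" "m \<in> T" for m n
    using that cong_trans cong_sym unfolding T_def by blast
  have "coprime n (int q)" if "n \<in> T" for n
    using that cong_imp_coprime[OF cong_sym, of n 1 "int q"] by (simp add: T_def)
  then have "unit_subgroup q T"
    unfolding unit_subgroup_def using one mult cong by blast
  moreover have "partial_character q T (\<lambda>n. if n \<in> T then 1 else 0)"
    unfolding partial_character_def using one mult cong cong_sym by (auto; blast)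
  moreover have "card (T \<inter> R) \<le> 1"
  proof -
    have "T \<inter> R \<subseteq> {1 mod int q}"
      using q by (auto simp: T_def R_def Cong.cong_def)
    then show ?thesis using card_mono[of "{1 mod int q}" "T \<inter> R"] by simp
  qed
  ultimately obtain F where F: "finite F" "\<forall>\<chi>\<in>F. partial_character q U \<chi>"
    "card F \<ge> card (U \<inter> R)"
    using step[of T "{\<lambda>n. if n \<in> T then 1 else 0}"] by auto
  have U: "unit_subgroup q U"
    unfolding unit_subgroup_def U_def
    using cong_imp_coprime by auto
  have dir: "dirichlet_character q \<chi>" if \<chi>: "partial_character q U \<chi>" for \<chi>
    unfolding dirichlet_character_def
  proof (intro conjI allI)
    show "\<chi> (m * n) = \<chi> m * \<chi> n" for m n
      using \<chi> by (cases "m \<in> U \<and> n \<in> U") (auto simp: partial_character_def U_def)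
    show "\<chi> (n + int q) = \<chi> n" for n
    proof -
      have "[n + int q = n] (mod int q)" by (simp add: Cong.cong_def)
      then show ?thesis using \<chi> unfolding partial_character_def by blast
    qed
    show "(\<chi> n \<noteq> 0) = coprime n (int q)" for n
      using \<chi> partial_character_nonzero[OF q U \<chi>, of n] by (auto simp: partial_character_def U_def)
  qed (use q in auto)
  have "totient q \<le> card (U \<inter> R)"
  proof -
    \<comment> \<open>For \<open>q = 1\<close> the only totative is 1, which lies outside
      \<open>R = {0}\<close>; the residue 0 takes its place.\<close>
    have "int ` (totatives q - {q}) \<union> (if q = 1 then {0} else {}) \<subseteq> U \<inter> R"
      by (auto simp: U_def R_def totatives_def le_less)
    moreover have "totient q \<le> card (int ` (totatives q - {q}) \<union> (if q = 1 then {0} else {}))"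
    proof (cases "q = 1")
      case False
      then have "q \<notin> totatives q" using q by (auto simp: totatives_def)
      then show ?thesis using False by (simp add: totient_def card_image)
    qed auto
    moreover have "finite (U \<inter> R)" by (simp add: R_def)
    ultimately show ?thesis using card_mono order_trans by blast
  qed
  then have "totient q \<le> card F" using F(3) by (rule order_trans)
  moreover have "\<forall>\<chi>\<in>F. dirichlet_character q \<chi>" using F(2) dir by blast
  ultimately show ?thesis using F(1) by blast
qed

section \<open>Totients and prime counting\<close>

text \<open>The worst case is \<open>A = {2..card A + 1}\<close>, where the product telescopes. The
  induction removes the maximum, which is at least \<open>card A + 1\<close>.\<close>

lemma prod_one_minus_inverse_ge:
  assumes "finite A" "\<And>a. a \<in> A \<Longrightarrow> (a::nat) \<ge> 2"
  shows "(\<Prod>a\<in>A. 1 - 1 / real a) \<ge> 1 / (real (card A) + 1)"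
  using assms
proof (induction "card A" arbitrary: A)
  case (Suc n)
  define m where "m = Max A"
  have ne: "A \<noteq> {}" using Suc.hyps by auto
  have m: "m \<in> A" using Suc.prems ne by (simp add: m_def)
  have "A \<subseteq> {2..m}"
    using Suc.prems by (auto simp: m_def)
  then have "card A \<le> card {2..m}" by (intro card_mono) auto
  then have mge: "m \<ge> n + 2" using Suc.hyps(2) Suc.prems(2)[OF m] by simp
  have cA: "card (A - {m}) = n" using m Suc.hyps Suc.prems by simp
  have "(\<Prod>a\<in>A. 1 - 1 / real a) = (1 - 1 / real m) * (\<Prod>a\<in>A - {m}. 1 - 1 / real a)"
    using Suc.prems m by (intro prod.remove) auto
  moreover have "(1 - 1 / real m) * (\<Prod>a\<in>A - {m}. 1 - 1 / real a) \<ge>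
      (1 - 1 / real (n + 2)) * (1 / (real n + 1))"
    using Suc.hyps(1)[of "A - {m}"] Suc.prems cA mge
    by (intro mult_mono) (auto simp: field_simps)
  moreover have "(1 - 1 / real (n + 2)) * (1 / (real n + 1)) = 1 / (real (n + 2))"
    by (simp add: divide_simps)
  moreover have "real (card A) + 1 = real (n + 2)" unfolding Suc.hyps(2)[symmetric] by simp
  ultimately show ?case by simp
qed auto

lemma power2_card_prime_factors_le:
  assumes "q > (0::nat)"
  shows "2 ^ card (prime_factors q) \<le> q"
proof -
  have "(2::nat) ^ card (prime_factors q) = (\<Prod>p\<in>prime_factors q. 2)" by simp
  also have "\<dots> \<le> (\<Prod>p\<in>prime_factors q. p)"
    by (intro prod_mono) (auto simp: in_prime_factors_iff prime_ge_2_nat)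
  also have "\<dots> \<le> q"
  proof (rule dvd_imp_le)
    have "(\<Prod>p\<in>prime_factors q. p ^ 1) dvd (\<Prod>p\<in>prime_factors q. p ^ multiplicity p q)"
      by (intro prod_dvd_prod le_imp_power_dvd)
        (auto simp: prime_factors_multiplicity)
    then show "\<Prod>(prime_factors q) dvd q"
      using prime_factorization_nat[OF assms] by simp
  qed fact
  finally show ?thesis .
qed

lemma card_prime_factors_le_ln:
  assumes "q > (0::nat)"
  shows "real (card (prime_factors q)) \<le> 2 * ln (real q)"
proof -
  have "ln (4::real) \<ge> 1" using exp_le by (subst ln_ge_iff) auto
  moreover have "ln (4::real) = 2 * ln 2" using ln_realpow[of 2 2] by simp
  ultimately have "ln (2::real) \<ge> 1 / 2" by linarith
  then have "real (card (prime_factors q)) * (1 / 2) \<le> real (card (prime_factors q)) * ln 2"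
    by (intro mult_left_mono) auto
  also have "\<dots> = ln (real (2 ^ card (prime_factors q)))" by (simp add: ln_realpow)
  also have "\<dots> \<le> ln (real q)"
    using power2_card_prime_factors_le[OF assms] assms
    by (subst ln_le_cancel_iff) (auto simp del: of_nat_power)
  finally show ?thesis by simp
qed

text \<open>In Euler's product for the totient the number of factors is at most
  \<open>2 * ln q\<close>; even if they came from consecutive integers, the product would lose only
  a logarithmic factor.\<close>

lemma totient_lower_bound:
  assumes "q > 0"
  shows "real (totient q) \<ge> real q / (2 * ln (real q) + 1)"
proof -
  have "real q / (2 * ln (real q) + 1) \<le> real q * (1 / (real (card (prime_factors q)) + 1))"
    using card_prime_factors_le_ln[OF assms] assms by (auto intro!: divide_left_mono mult_pos_pos
       add_nonneg_pos)
  also have "\<dots> \<le> real q * (\<Prod>p\<in>prime_factors q. 1 - 1 / real p)"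
    by (intro mult_left_mono prod_one_minus_inverse_ge)
      (auto simp: prime_ge_2_nat dest: in_prime_factors_imp_prime)
  finally show ?thesis by (simp add: totient_formula2)
qed

text \<open>The entries \<open>(n + 1) (n choose k)\<close> of the Leibniz harmonic triangle satisfy
  \<open>1 / a(n + 1, k + 1) = 1 / a(n, k) - 1 / a(n + 1, k)\<close>.\<close>

lemma leibniz_triangle_dvd:
  assumes "\<And>j. j \<in> {1..n + 1} \<Longrightarrow> j dvd N" "k \<le> n"
  shows "(n + 1) * (n choose k) dvd N"
  using assms
proof (induction k arbitrary: n)
  case (Suc k)
  then obtain m where m: "n = Suc m" by (cases n) auto
  have k: "k \<le> m" using Suc.prems m by simp
  have d1: "(m + 1) * (m choose k) dvd N"
    using Suc.prems m by (intro Suc.IH) auto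
  have d2: "(n + 1) * (n choose k) dvd N"
    using Suc.prems by (intro Suc.IH) auto
  define a where "a = (m + 1) * (m choose k)"
  define b where "b = (n + 1) * (n choose k)"
  define c where "c = (n + 1) * (n choose Suc k)"
  obtain s t where s: "N = a * s" and t: "N = b * t"
    using d1 d2 unfolding a_def b_def by (metis dvdE)
  have "(k + 1) * (n choose Suc k) = a"
    using binomial_absorption[of k n] m by (simp add: a_def del: binomial_Suc_Suc)
  then have c: "real (k + 1) * real c = real (n + 1) * real a"
    unfolding c_def by (metis mult.left_commute of_nat_mult)
  have "(n - k) * (n choose k) = a"
    using binomial_absorb_comp[of n k] m by (simp add: a_def)
  then have "(n - k) * b = (n + 1) * a"
    unfolding b_def by (metis mult.left_commute)
  then have "real (n - k) * real b = real (n + 1) * real a"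
    by (metis of_nat_mult)
  then have b: "(real n - real k) * real b = real (n + 1) * real a"
    using k m by (simp add: of_nat_diff)
  \<comment> \<open>Multiplying the identity \<open>1 / c = 1 / a - 1 / b\<close> by
    \<open>N\<close> gives \<open>N / c = s - t\<close>. Working in the reals avoids truncated
    subtraction.\<close>
  have "real N = real c * (real s - real t)"
  proof -
    have "(real k + 1) * (real c * (real s - real t)) = (real (k + 1) * real c) * (real s - real t)"
      by simp
    also have "\<dots> = real (n + 1) * (real a * real s) - (real (n + 1) * real a) * real t"
      unfolding c by (simp add: algebra_simps)
    also have "\<dots> = real (n + 1) * (real a * real s) - (real n - real k) * (real b * real t)"
      unfolding b[symmetric] by (simp add: mult.assoc)
    also have "real a * real s = real N" using s by simp
    also have "real b * real t = real N" using t by simp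
    also have "real (n + 1) * real N - (real n - real k) * real N = (real k + 1) * real N"
      by (simp add: algebra_simps)
    finally have "real c * (real s - real t) = real N"
      by (subst (asm) mult_cancel_left) linarith
    then show ?thesis by simp
  qed
  then have "real_of_int (int N) = real_of_int (int c * (int s - int t))" by simp
  then have "int N = int c * (int s - int t)" by (simp only: of_int_eq_iff)
  then have "int c dvd int N" by (metis dvd_triv_left)
  then show ?case unfolding c_def by (simp only: int_dvd_int_iff)
qed auto

text \<open>Nair's argument. \<open>N\<close> is the least common multiple of
  \<open>1, ..., 2 * n + 1\<close>. Each prime power in it is at most \<open>2 * n + 1\<close>,
  which bounds it above; it is a multiple of \<open>(2 * n + 1) * (2 * n choose n)\<close>, which
  bounds it below by \<open>4 ^ n\<close>.\<close>

lemma four_power_le_power_prime_count: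
  assumes "n > 0"
  shows "4 ^ n \<le> (2 * n + 1) ^ card {p. prime p \<and> p \<le> 2 * n + 1}"
proof -
  define M where "M = 2 * n + 1"
  define P where "P = {p. prime p \<and> p \<le> M}"
  define e where "e = (\<lambda>p. Max ((\<lambda>j. multiplicity p j) ` {1..M}))"
  define N where "N = (\<Prod>p\<in>P. p ^ e p)"
  have M: "M \<ge> 1" by (simp add: M_def)
  have finP: "finite P" by (auto simp: P_def)
  have "p ^ e p \<le> M" if "p \<in> P" for p
  proof -
    have "e p \<in> (\<lambda>j. multiplicity p j) ` {1..M}"
      unfolding e_def using M by (intro Max_in) auto
    then obtain j where j: "j \<in> {1..M}" "e p = multiplicity p j" by auto
    then have "p ^ e p dvd j" by (simp add: multiplicity_dvd)
    then show ?thesis using j by (auto dest: dvd_imp_le)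
  qed
  then have "N \<le> (\<Prod>p\<in>P. M)"
    unfolding N_def by (intro prod_mono) auto
  then have NM: "N \<le> M ^ card P" by simp
  have "j dvd N" if j: "j \<in> {1..2 * n + 1}" for j
  proof -
    have "j = (\<Prod>p\<in>prime_factors j. p ^ multiplicity p j)"
      using j by (intro prime_factorization_nat) auto
    also have "\<dots> dvd (\<Prod>p\<in>prime_factors j. p ^ e p)"
      using j by (intro prod_dvd_prod le_imp_power_dvd) (auto simp: e_def M_def)
    also have "\<dots> dvd N"
      unfolding N_def using finP j
      by (intro prod_dvd_prod_subset) (auto simp: P_def M_def in_prime_factors_iff
        intro: order_trans[OF dvd_imp_le])
    finally show ?thesis .
  qed
  then have "(2 * n + 1) * (2 * n choose n) dvd N"
    by (intro leibniz_triangle_dvd) auto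
  moreover have "N > 0" unfolding N_def P_def by (auto simp: prime_gt_0_nat)
  ultimately have "(2 * n + 1) * (2 * n choose n) \<le> N" by (intro dvd_imp_le)
  moreover have "4 ^ n \<le> (2 * n + 1) * (2 * n choose n)"
  proof -
    have "4 ^ n \<le> 2 * real n * real (2 * n choose n)"
      using central_binomial_lower_bound[OF assms] assms by (simp add: field_simps)
    also have "\<dots> = real (2 * n * (2 * n choose n))" by simp
    finally have "4 ^ n \<le> 2 * n * (2 * n choose n)"
      by (metis of_nat_le_iff of_nat_numeral of_nat_power)
    then show ?thesis by simp
  qed
  ultimately show ?thesis using NM by (simp add: M_def P_def)
qed

lemma prime_count_lower_bound:
  fixes y :: real
  assumes "y \<ge> 8"
  shows "real (card {p::nat. prime p \<and> real p \<le> y}) \<ge> y / (4 * ln y)"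
proof -
  define n where "n = nat \<lfloor>(y - 1) / 2\<rfloor>"
  define Q where "Q = {p::nat. prime p \<and> real p \<le> y}"
  have n: "real n \<le> (y - 1) / 2" "real n > (y - 1) / 2 - 1"
    using assms of_int_floor_le[of "(y - 1) / 2"] by (auto simp: n_def)
  have "real n > 0" using n assms by argo
  then have "n > 0" by simp
  have ny: "real (2 * n + 1) \<le> y" using n by simp
  have finQ: "finite Q"
    by (rule finite_subset[of _ "{..nat \<lfloor>y\<rfloor>}"]) (auto simp: Q_def le_nat_floor)
  have "card {p. prime p \<and> p \<le> 2 * n + 1} \<le> card Q"
    using ny finQ by (intro card_mono) (auto simp: Q_def)
  then have "(2 * n + 1) ^ card {p. prime p \<and> p \<le> 2 * n + 1} \<le> (2 * n + 1) ^ card Q"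
    by (intro power_increasing) auto
  then have "real (4 ^ n) \<le> real ((2 * n + 1) ^ card Q)"
    using four_power_le_power_prime_count[OF \<open>n > 0\<close>] by (subst of_nat_le_iff) linarith
  then have "(4::real) ^ n \<le> real (2 * n + 1) ^ card Q"
    by (simp del: of_nat_add of_nat_mult of_nat_Suc)
  also have "\<dots> \<le> y ^ card Q" using ny by (intro power_mono) auto
  finally have "real n * ln 4 \<le> real (card Q) * ln y"
    using assms by (subst (asm) ln_le_cancel_iff[symmetric]) (auto simp: ln_realpow)
  moreover have "y / 4 \<le> real n * ln 4"
  proof -
    have "ln (4::real) \<ge> 1" using ln_ge_iff[of 4 1] exp_le by simp
    then have "real n * 1 \<le> real n * ln 4" by (intro mult_left_mono) auto
    moreover have "y / 4 \<le> real n" using n assms by argo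
    ultimately show ?thesis by simp
  qed
  moreover have "ln y > 0" using assms by simp
  ultimately show ?thesis unfolding Q_def[symmetric] by (simp add: field_simps)
qed

section \<open>Character sums\<close>

text \<open>Both sides expand to the same fourfold sum: they are the squared Frobenius norms of the
  two Gram matrices of \<open>f\<close>. This exchanges pairs of characters for pairs of
  integers.\<close>

lemma gram_matrix_sum_norm_squared:
  fixes f :: "'a \<Rightarrow> 'b \<Rightarrow> complex"
  shows "(\<Sum>k\<in>K. \<Sum>l\<in>K. (norm (\<Sum>n\<in>N. f k n * cnj (f l n)))\<^sup>2) =
    (\<Sum>n\<in>N. \<Sum>m\<in>N. (norm (\<Sum>k\<in>K. f k n * cnj (f k m)))\<^sup>2)"
proof -
  have sq: "complex_of_real ((norm (\<Sum>x\<in>A. h x))\<^sup>2) = (\<Sum>x\<in>A. \<Sum>y\<in>A. h x * cnj (h y))"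
    for h :: "'a \<Rightarrow> complex" and A
    by (simp only: complex_norm_square cnj_sum sum_product)
  have sq': "complex_of_real ((norm (\<Sum>x\<in>A. h x))\<^sup>2) = (\<Sum>x\<in>A. \<Sum>y\<in>A. h x * cnj (h y))"
    for h :: "'b \<Rightarrow> complex" and A
    by (simp only: complex_norm_square cnj_sum sum_product)
  have "complex_of_real (\<Sum>k\<in>K. \<Sum>l\<in>K. (norm (\<Sum>n\<in>N. f k n * cnj (f l n)))\<^sup>2) =
      (\<Sum>k\<in>K. \<Sum>l\<in>K. \<Sum>n\<in>N. \<Sum>m\<in>N. (f k n * cnj (f l n)) * cnj (f k m * cnj (f l m)))"
    by (simp only: of_real_sum sq sq')
  also have "\<dots> = (\<Sum>k\<in>K. \<Sum>n\<in>N. \<Sum>l\<in>K. \<Sum>m\<in>N. (f k n * cnj (f l n)) * cnj (f k m * cnj (f l m)))"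
    by (intro sum.cong refl sum.swap)
  also have "\<dots> = (\<Sum>n\<in>N. \<Sum>k\<in>K. \<Sum>l\<in>K. \<Sum>m\<in>N. (f k n * cnj (f l n)) * cnj (f k m * cnj (f l m)))"
    by (rule sum.swap)
  also have "\<dots> = (\<Sum>n\<in>N. \<Sum>k\<in>K. \<Sum>m\<in>N. \<Sum>l\<in>K. (f k n * cnj (f l n)) * cnj (f k m * cnj (f l m)))"
    by (intro sum.cong refl sum.swap)
  also have "\<dots> = (\<Sum>n\<in>N. \<Sum>m\<in>N. \<Sum>k\<in>K. \<Sum>l\<in>K. (f k n * cnj (f l n)) * cnj (f k m * cnj (f l m)))"
    by (intro sum.cong refl sum.swap)
  also have "\<dots> = (\<Sum>n\<in>N. \<Sum>m\<in>N. \<Sum>k\<in>K. \<Sum>l\<in>K. (f k n * cnj (f k m)) * cnj (f l n * cnj (f l m)))"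
    by (simp add: mult_ac)
  also have "\<dots> = complex_of_real (\<Sum>n\<in>N. \<Sum>m\<in>N. (norm (\<Sum>k\<in>K. f k n * cnj (f k m)))\<^sup>2)"
    by (simp only: of_real_sum sq sq')
  finally show ?thesis by (simp only: of_real_eq_iff)
qed

text \<open>For \<open>|z| = |w| = 1\<close> one has
  \<open>Re (z * cnj w) = 1 - |z - w|^2 / 2\<close>, and two points in one square of side
  \<open>1 / 2\<close> satisfy \<open>|z - w|^2 \<le> 1 / 2\<close>.\<close>

lemma pigeonhole_nearby_values:
  fixes f :: "'a \<Rightarrow> 'b \<Rightarrow> complex"
  assumes "finite F" "finite P" "\<And>k p. k \<in> F \<Longrightarrow> p \<in> P \<Longrightarrow> norm (f k p) = 1"
  shows "\<exists>K\<subseteq>F. card F \<le> card K * 25 ^ card P \<and>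
    (\<forall>k\<in>K. \<forall>l\<in>K. \<forall>p\<in>P. Re (f k p * cnj (f l p)) \<ge> 3 / 4)"
proof -
  \<comment> \<open>For \<open>|t| \<le> 1\<close> the number \<open>\<lfloor>2 * t\<rfloor>\<close>
    takes five values, which gives 25 squares for each \<open>p\<close>.\<close>
  define cell where "cell = (\<lambda>k. \<lambda>p\<in>P. (\<lfloor>2 * Re (f k p)\<rfloor>, \<lfloor>2 * Im (f k p)\<rfloor>))"
  define B where "B = (P \<rightarrow>\<^sub>E ({-2..2::int} \<times> {-2..2::int}))"
  have "cell \<in> F \<rightarrow> B"
  proof (intro funcsetI)
    fix k assume k: "k \<in> F"
    have "\<lfloor>2 * t\<rfloor> \<in> {-2..2}" if "\<bar>t\<bar> \<le> 1" for t :: real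
      using that by (auto simp: le_floor_iff floor_le_iff)
    then have "(\<lfloor>2 * Re (f k p)\<rfloor>, \<lfloor>2 * Im (f k p)\<rfloor>) \<in> {-2..2} \<times> {-2..2}" if "p \<in> P" for p
      using abs_Re_le_cmod[of "f k p"] abs_Im_le_cmod[of "f k p"] assms(3)[OF k that]
      by (intro SigmaI) auto
    then show "cell k \<in> B" unfolding cell_def B_def by (intro restrict_PiE_iff[THEN iffD2] ballI)
  qed
  moreover have "card B = 25 ^ card P"
    unfolding B_def using assms by (simp add: card_PiE card_cartesian_product)
  moreover have "finite B" "B \<noteq> {}"
    unfolding B_def using assms by (auto intro!: finite_PiE simp: PiE_eq_empty_iff)
  ultimately obtain c where c: "card (cell -` {c} \<inter> F) * 25 ^ card P \<ge> card F"
    using pigeonhole_card[of cell F B] assms by auto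
  define K where "K = cell -` {c} \<inter> F"
  have "Re (f k p * cnj (f l p)) \<ge> 3 / 4" if kl: "k \<in> K" "l \<in> K" "p \<in> P" for k l p
  proof -
    define z w where "z = f k p" and "w = f l p"
    have "cell k p = cell l p" using kl by (simp add: K_def)
    then have fl: "\<lfloor>2 * Re z\<rfloor> = \<lfloor>2 * Re w\<rfloor>" "\<lfloor>2 * Im z\<rfloor> = \<lfloor>2 * Im w\<rfloor>"
      using kl by (auto simp: cell_def z_def w_def)
    have "(s - t)\<^sup>2 \<le> 1 / 4" if "\<lfloor>2 * s\<rfloor> = \<lfloor>2 * t\<rfloor>" for s t :: real
    proof -
      have "\<bar>s - t\<bar> \<le> 1 / 2" using that by linarith
      then have "\<bar>s - t\<bar>\<^sup>2 \<le> (1 / 2)\<^sup>2" by (intro power_mono) auto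
      then show ?thesis by (simp add: power2_eq_square)
    qed
    from this[OF fl(1)] this[OF fl(2)]
    have "(Re z - Re w)\<^sup>2 + (Im z - Im w)\<^sup>2 \<le> 1 / 2" by simp
    moreover have "(Re z)\<^sup>2 + (Im z)\<^sup>2 = 1" "(Re w)\<^sup>2 + (Im w)\<^sup>2 = 1"
      using assms(3) kl by (auto simp: K_def z_def w_def simp flip: cmod_power2)
    moreover have "Re (z * cnj w) = Re z * Re w + Im z * Im w" by simp
    ultimately have "Re (z * cnj w) \<ge> 3 / 4" by (simp add: power2_diff)
    then show ?thesis by (simp add: z_def w_def)
  qed
  then show ?thesis using c by (intro exI[of _ K]) (auto simp: K_def)
qed

section \<open>Basic properties of Dirichlet characters\<close>

text \<open>Invariance under the shift by \<open>q\<close> is upgraded to invariance under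
  congruence, so that the facts about characters of subgroups apply with the whole unit group as
  subgroup.\<close>

lemma dirichlet_character_partial_character:
  assumes "dirichlet_character q \<chi>"
  shows "q > 0" "unit_subgroup q {n. coprime n (int q)}"
    "partial_character q {n. coprime n (int q)} \<chi>"
proof -
  show q: "q > 0" using assms by (simp add: dirichlet_character_def)
  show "unit_subgroup q {n. coprime n (int q)}"
    unfolding unit_subgroup_def using cong_imp_coprime by auto
  have mult: "\<chi> (m * n) = \<chi> m * \<chi> n" and per: "\<chi> (n + int q) = \<chi> n"
    and nz: "\<chi> n \<noteq> 0 \<longleftrightarrow> coprime n (int q)" for m n
    using assms by (auto simp: dirichlet_character_def)
  have "\<chi> 1 * \<chi> 1 = \<chi> 1" "\<chi> 1 \<noteq> 0" using mult[of 1 1] nz[of 1] by auto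
  then have one: "\<chi> 1 = 1" by simp
  have per': "\<chi> (n + int j * int q) = \<chi> n" for n j
  proof (induction j)
    case (Suc j)
    then show ?case using per[of "n + int j * int q"] by (simp add: algebra_simps)
  qed auto
  have "\<chi> n = \<chi> (n mod int q)" for n
  proof (cases "n \<ge> 0")
    case True
    then have "n = n mod int q + int (nat (n div int q)) * int q"
      using q by (simp add: pos_imp_zdiv_nonneg_iff)
    then show ?thesis using per' by metis
  next
    case False
    then have "n div int q \<le> 0" using q by (simp add: div_nonpos_pos_le0)
    then have "n mod int q = n + int (nat (- (n div int q))) * int q"
      by (simp add: minus_div_mult_eq_mod [symmetric] algebra_simps)
    then show ?thesis using per' by metis
  qed
  then have "\<chi> m = \<chi> n" if "[m = n] (mod int q)" for m n
    using that unfolding Cong.cong_def by metis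
  then show "partial_character q {n. coprime n (int q)} \<chi>"
    unfolding partial_character_def using mult one nz by blast
qed

lemma dirichlet_character_norm:
  assumes "dirichlet_character q \<chi>" "coprime n (int q)"
  shows "norm (\<chi> n) = 1"
proof -
  note * = dirichlet_character_partial_character[OF assms(1)]
  have "[n ^ totient q = 1] (mod int q)" using *(1) assms(2) by (rule euler_theorem_int)
  then have "\<chi> (n ^ totient q) = 1" using *(3) by (auto simp: partial_character_def)
  then have "\<chi> n ^ totient q = 1"
    using partial_character_power[OF *(2,3)] assms(2) by simp
  then have "norm (\<chi> n) ^ totient q = 1 ^ totient q" by (metis norm_one norm_power power_one)
  moreover have "totient q > 0" using *(1) by simp
  ultimately show ?thesis
    using power_eq_imp_eq_base[of "norm (\<chi> n)" "totient q" 1] by simp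
qed

lemma dirichlet_character_mult_cnj:
  assumes "dirichlet_character q \<chi>" "dirichlet_character q \<psi>"
  shows "dirichlet_character q (\<lambda>n. \<chi> n * cnj (\<psi> n))"
  using assms by (auto simp: dirichlet_character_def)

text \<open>On units \<open>cnj (\<psi> n)\<close> is the inverse of \<open>\<psi> n\<close>, so a
  principal quotient forces the two characters to agree.\<close>

lemma dirichlet_character_mult_cnj_nonprincipal:
  assumes "dirichlet_character q \<chi>" "dirichlet_character q \<psi>" "\<chi> \<noteq> \<psi>"
  shows "(\<lambda>n. \<chi> n * cnj (\<psi> n)) \<noteq> principal_character q"
proof
  assume eq: "(\<lambda>n. \<chi> n * cnj (\<psi> n)) = principal_character q"
  have "\<chi> n = \<psi> n" for n
  proof (cases "coprime n (int q)")
    case True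
    have "\<psi> n * cnj (\<psi> n) = 1"
      using dirichlet_character_norm[OF assms(2) True] complex_norm_square[of "\<psi> n"] by simp
    moreover have "\<chi> n * cnj (\<psi> n) = 1"
      using fun_cong[OF eq, of n] True by (simp add: principal_character_def)
    ultimately show ?thesis by (metis mult_cancel_right zero_neq_one mult_zero_right)
  next
    case False
    then show ?thesis using assms by (metis dirichlet_character_def)
  qed
  with assms(3) show False by auto
qed

lemma dirichlet_character_prod:
  assumes "dirichlet_character q \<chi>" "finite A"
  shows "\<chi> (\<Prod>a\<in>A. h a) = (\<Prod>a\<in>A. \<chi> (h a))"
  using assms(2)
proof induction
  case empty
  show ?case using dirichlet_character_partial_character(3)[OF assms(1)]
    by (simp add: partial_character_def)
next
  case (insert a A)
  then show ?case using assms(1) by (simp add: dirichlet_character_def)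
qed

text \<open>By \<open>gram_matrix_sum_norm_squared\<close>, the sum of \<open>|S(\<chi> \<psi>\<inverse>)|\<^sup>2\<close> over pairs of characters
  is a sum of nonnegative terms over pairs \<open>(n, m)\<close>, of which only the pairs \<open>(b a, b a')\<close>, with
  \<open>a\<close> and \<open>a'\<close> products of one prime from each \<open>G i\<close>, are kept. The subtracted term pays for the
  diagonal \<open>\<chi> = \<psi>\<close>.\<close>

lemma nonprincipal_character_sum_lower_bound:
  fixes q r g X :: nat and G :: "nat \<Rightarrow> nat set" and B :: "nat set"
  assumes q: "q > 0" and g: "g > 0"
    and G: "\<And>i. i < r \<Longrightarrow> card (G i) = g"
           "\<And>i p. i < r \<Longrightarrow> p \<in> G i \<Longrightarrow> prime p \<and> coprime p q"
           "disjoint_family_on G {..<r}"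
    and B: "finite B" "\<And>b. b \<in> B \<Longrightarrow> b > 0 \<and> coprime b q"
           "\<And>b i p. b \<in> B \<Longrightarrow> i < r \<Longrightarrow> p \<in> G i \<Longrightarrow> \<not> p dvd b"
    and X: "\<And>b s. b \<in> B \<Longrightarrow> s \<in> PiE {..<r} G \<Longrightarrow> b * (\<Prod>i<r. s i) \<le> X"
    and pos: "real (card B) * (3 / 4 * real g) ^ (2 * r) > (real X)\<^sup>2 * 25 ^ (r * g) / real (totient q)"
  shows "\<exists>\<chi>. dirichlet_character q \<chi> \<and> \<chi> \<noteq> principal_character q \<and>
    (norm (\<Sum>n = 1..int X. \<chi> n))\<^sup>2 \<ge>
      real (card B) * (3 / 4 * real g) ^ (2 * r) - (real X)\<^sup>2 * 25 ^ (r * g) / real (totient q)"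
proof -
  obtain F where F: "finite F" "\<And>\<chi>. \<chi> \<in> F \<Longrightarrow> dirichlet_character q \<chi>" "card F \<ge> totient q"
    using dirichlet_characters_card_ge[OF q] by blast
  define P where "P = (\<Union>i<r. G i)"
  have finG: "finite (G i)" if "i < r" for i using G(1)[OF that] g card_ge_0_finite by metis
  have finP: "finite P" unfolding P_def using finG by auto
  have cardP: "card P = r * g"
  proof -
    have "card P = (\<Sum>i<r. card (G i))"
      unfolding P_def using finG G(3) by (intro card_UN_disjoint) (auto simp: disjoint_family_on_def)
    then show ?thesis using G(1) by simp
  qed
  have "norm (\<chi> (int p)) = 1" if "\<chi> \<in> F" "p \<in> P" for \<chi> p
    using that F(2) G(2) by (intro dirichlet_character_norm) (auto simp: P_def)
  then obtain K where K: "K \<subseteq> F" "card F \<le> card K * 25 ^ (r * g)"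
    "\<And>k l p. k \<in> K \<Longrightarrow> l \<in> K \<Longrightarrow> p \<in> P \<Longrightarrow> Re (k (int p) * cnj (l (int p))) \<ge> 3 / 4"
    using pigeonhole_nearby_values[OF F(1) finP, of "\<lambda>\<chi> p. \<chi> (int p)"] cardP by auto
  have Kd: "dirichlet_character q k" if "k \<in> K" for k using that K(1) F(2) by blast
  have finK: "finite K" using K(1) F(1) finite_subset by blast
  have cardK: "real (totient q) \<le> real (card K) * 25 ^ (r * g)"
  proof -
    have "totient q \<le> card K * 25 ^ (r * g)" using F(3) K(2) by linarith
    then have "real (totient q) \<le> real (card K * 25 ^ (r * g))" by (rule of_nat_mono)
    then show ?thesis by simp
  qed
  have totpos: "real (totient q) > 0" using q by simp
  have Kpos: "real (card K) > 0"
    using cardK totpos by (cases "card K = 0") auto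
  define Sel where "Sel = PiE {..<r} G"
  define a where "a = (\<lambda>s :: nat \<Rightarrow> nat. \<Prod>i<r. s i)"
  have finSel: "finite Sel" unfolding Sel_def using finG by (intro finite_PiE) auto
  have apos: "a s > 0" if "s \<in> Sel" for s
    unfolding a_def
  proof (intro prod_pos)
    fix i assume "i \<in> {..<r}"
    then have "prime (s i)" using that G(2)[of i "s i"] by (auto simp: Sel_def)
    then show "0 < s i" by (rule prime_gt_0_nat)
  qed
  define h where "h = (\<lambda>n m. (norm (\<Sum>k\<in>K. k n * cnj (k m)))\<^sup>2)"
  define T where "T = (\<Sum>k\<in>K. \<Sum>l\<in>K. (norm (\<Sum>n = 1..int X. k n * cnj (l n)))\<^sup>2)"
  \<comment> \<open>A prime of \<open>G i\<close> divides no \<open>b \<in> B\<close> and, by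
    disjointness, no factor taken from another class. Hence the product \<open>b * a s\<close>
    determines first \<open>s\<close> and then \<open>b\<close>, and distinct triples
    \<open>(b, s, s')\<close> give distinct pairs of integers.\<close>
  have recover: "s i = (THE p. p \<in> G i \<and> p dvd b * a s)"
    if "b \<in> B" "s \<in> Sel" "i < r" for b s i
  proof (rule the_equality[symmetric])
    have si: "s j \<in> G j" if "j < r" for j using \<open>s \<in> Sel\<close> that by (auto simp: Sel_def)
    show "s i \<in> G i \<and> s i dvd b * a s"
      using si that unfolding a_def by (auto intro!: dvd_mult dvd_prodI)
    fix p assume p: "p \<in> G i \<and> p dvd b * a s"
    then have pr: "prime p" using G(2) that by auto
    have "p dvd a s" using p B(3) that pr prime_dvd_mult_iff by blast
    then obtain j where j: "j < r" "p dvd s j"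
      using pr unfolding a_def by (auto simp: prime_dvd_prod_iff)
    have "p = s j" using j pr G(2)[OF j(1) si[OF j(1)]] primes_dvd_imp_eq by blast
    moreover from this have "j = i"
      using p si[OF j(1)] j(1) that G(3) by (auto simp: disjoint_family_on_def)
    ultimately show "p = s i" by simp
  qed
  have inj: "b = b' \<and> s = s'"
    if bs: "b \<in> B" "s \<in> Sel" "b' \<in> B" "s' \<in> Sel" "b * a s = b' * a s'" for b s b' s'
  proof -
    have "s = s'"
    proof (rule PiE_ext)
      show "s \<in> PiE {..<r} G" "s' \<in> PiE {..<r} G" using bs by (auto simp: Sel_def)
      show "s i = s' i" if "i \<in> {..<r}" for i
        using recover[of b s i] recover[of b' s' i] bs that by simp
    qed
    moreover have "a s > 0"
      using bs(2) by (rule apos)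
    ultimately show ?thesis using bs(5) by auto
  qed
  have "T = (\<Sum>n = 1..int X. \<Sum>m = 1..int X. h n m)"
    unfolding T_def h_def by (rule gram_matrix_sum_norm_squared)
  also have "\<dots> = (\<Sum>(n, m)\<in>{1..int X} \<times> {1..int X}. h n m)"
    by (rule sum.cartesian_product)
  also have "\<dots> \<ge> (\<Sum>(n, m)\<in>(\<lambda>(b, s, s'). (int (b * a s), int (b * a s'))) ` (B \<times> Sel \<times> Sel). h n m)"
  proof (rule sum_mono2)
    have "b * a s > 0" if "b \<in> B" "s \<in> Sel" for b s
      using that B(2) apos by simp
    moreover have "b * a s \<le> X" if "b \<in> B" "s \<in> Sel" for b s
      using that X by (auto simp: a_def Sel_def)
    ultimately have "int (b * a s) \<in> {1..int X}" if "b \<in> B" "s \<in> Sel" for b s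
      using that by (simp only: atLeastAtMost_iff of_nat_le_iff) (metis Suc_leI int_ops(2) of_nat_le_iff One_nat_def)
    then show "(\<lambda>(b, s, s'). (int (b * a s), int (b * a s'))) ` (B \<times> Sel \<times> Sel)
        \<subseteq> {1..int X} \<times> {1..int X}"
      by (auto simp del: of_nat_mult)
  qed (auto simp: h_def)
  also have "(\<Sum>(n, m)\<in>(\<lambda>(b, s, s'). (int (b * a s), int (b * a s'))) ` (B \<times> Sel \<times> Sel). h n m) =
      (\<Sum>(b, s, s')\<in>B \<times> Sel \<times> Sel. h (int (b * a s)) (int (b * a s')))"
  proof (subst sum.reindex)
    show "inj_on (\<lambda>(b, s, s'). (int (b * a s), int (b * a s'))) (B \<times> Sel \<times> Sel)"
      by (rule inj_onI) (use inj in \<open>auto simp del: of_nat_mult\<close>)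
  qed (simp add: split_def)
  \<comment> \<open>The common factor \<open>b\<close> contributes \<open>|k(b)|^2 = 1\<close>, so
    summing over \<open>b\<close> merely multiplies by \<open>card B\<close>.\<close>
  also have "\<dots> = (\<Sum>(b, s, s')\<in>B \<times> Sel \<times> Sel. h (int (a s)) (int (a s')))"
  proof (intro sum.cong refl, clarify)
    fix b s s' assume b: "b \<in> B"
    have "k (int (b * a s)) * cnj (k (int (b * a s'))) = k (int (a s)) * cnj (k (int (a s')))"
      if k: "k \<in> K" for k
    proof -
      have "norm (k (int b)) = 1"
        using B(2)[OF b] Kd[OF k] by (intro dirichlet_character_norm) auto
      then have "k (int b) * cnj (k (int b)) = 1"
        using complex_norm_square[of "k (int b)"] by simp
      moreover have "k (m * n) = k m * k n" for m n
        using Kd[OF k] by (simp add: dirichlet_character_def)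
      ultimately show ?thesis by (simp add: mult_ac)
    qed
    then show "h (int (b * a s)) (int (b * a s')) = h (int (a s)) (int (a s'))"
      unfolding h_def by (metis (mono_tags, lifting) sum.cong)
  qed
  also have "\<dots> = real (card B) * (\<Sum>s\<in>Sel. \<Sum>s'\<in>Sel. h (int (a s)) (int (a s')))"
    by (simp add: sum.cartesian_product[symmetric])
  \<comment> \<open>The duality is now used backwards, returning to pairs of characters with sums
    over \<open>Sel\<close> only.\<close>
  also have "(\<Sum>s\<in>Sel. \<Sum>s'\<in>Sel. h (int (a s)) (int (a s'))) =
      (\<Sum>k\<in>K. \<Sum>l\<in>K. (norm (\<Sum>s\<in>Sel. k (int (a s)) * cnj (l (int (a s)))))\<^sup>2)"
    unfolding h_def by (rule gram_matrix_sum_norm_squared[symmetric])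
  finally have Tge: "T \<ge> real (card B) *
      (\<Sum>k\<in>K. \<Sum>l\<in>K. (norm (\<Sum>s\<in>Sel. k (int (a s)) * cnj (l (int (a s)))))\<^sup>2)" .
  \<comment> \<open>The sum over \<open>Sel\<close> factors as a product over \<open>i < r\<close>,
    and each factor has real part at least \<open>3 / 4 * g\<close> by the choice of
    \<open>K\<close>.\<close>
  have lower: "(\<Sum>k\<in>K. \<Sum>l\<in>K. (norm (\<Sum>s\<in>Sel. k (int (a s)) * cnj (l (int (a s)))))\<^sup>2)
      \<ge> (\<Sum>k\<in>K. \<Sum>l\<in>K. (3 / 4 * real g) ^ (2 * r))"
  proof (intro sum_mono)
    fix k l assume kl: "k \<in> K" "l \<in> K"
    have "(\<Sum>s\<in>Sel. k (int (a s)) * cnj (l (int (a s)))) =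
        (\<Sum>s\<in>Sel. \<Prod>i<r. k (int (s i)) * cnj (l (int (s i))))"
    proof (intro sum.cong refl)
      fix s
      have "m (int (a s)) = (\<Prod>i<r. m (int (s i)))" if "m \<in> K" for m
        using dirichlet_character_prod[OF Kd[OF that], of "{..<r}" "\<lambda>i. int (s i)"]
        by (simp add: a_def)
      from this[OF kl(1)] this[OF kl(2)]
      show "k (int (a s)) * cnj (l (int (a s))) = (\<Prod>i<r. k (int (s i)) * cnj (l (int (s i))))"
        by (simp add: prod.distrib)
    qed
    also have "\<dots> = (\<Prod>i<r. \<Sum>p\<in>G i. k (int p) * cnj (l (int p)))"
      unfolding Sel_def using finG by (intro prod_sum_PiE[symmetric]) auto
    finally have "norm (\<Sum>s\<in>Sel. k (int (a s)) * cnj (l (int (a s)))) =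
        (\<Prod>i<r. norm (\<Sum>p\<in>G i. k (int p) * cnj (l (int p))))"
      by (simp add: prod_norm)
    also have "\<dots> \<ge> (\<Prod>i<r. 3 / 4 * real g)"
    proof (intro prod_mono conjI)
      fix i assume i: "i \<in> {..<r}"
      have "3 / 4 * real g = (\<Sum>p\<in>G i. 3 / 4)" using G(1) i by simp
      also have "\<dots> \<le> (\<Sum>p\<in>G i. Re (k (int p) * cnj (l (int p))))"
        using K(3) kl i by (intro sum_mono) (auto simp: P_def)
      also have "\<dots> = Re (\<Sum>p\<in>G i. k (int p) * cnj (l (int p)))" by (simp only: Re_sum)
      also have "\<dots> \<le> norm (\<Sum>p\<in>G i. k (int p) * cnj (l (int p)))" by (rule complex_Re_le_cmod)
      finally show "3 / 4 * real g \<le> norm (\<Sum>p\<in>G i. k (int p) * cnj (l (int p)))" .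
    qed auto
    finally have "(3 / 4 * real g) ^ r \<le> norm (\<Sum>s\<in>Sel. k (int (a s)) * cnj (l (int (a s))))"
      by simp
    then have "((3 / 4 * real g) ^ r)\<^sup>2 \<le> (norm (\<Sum>s\<in>Sel. k (int (a s)) * cnj (l (int (a s)))))\<^sup>2"
      by (intro power_mono) auto
    then show "(3 / 4 * real g) ^ (2 * r) \<le> (norm (\<Sum>s\<in>Sel. k (int (a s)) * cnj (l (int (a s)))))\<^sup>2"
      by (simp add: power_mult[symmetric] mult.commute)
  qed
  have TgeW: "T \<ge> real (card B) * (\<Sum>k\<in>K. \<Sum>l\<in>K. (3 / 4 * real g) ^ (2 * r))"
    using Tge mult_left_mono[OF lower, of "real (card B)"] by simp
  define W where "W = real (card B) * (3 / 4 * real g) ^ (2 * r)"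
  define E where "E = (real X)\<^sup>2 * 25 ^ (r * g) / real (totient q)"
  have TW: "T \<ge> (real (card K))\<^sup>2 * W"
    using TgeW by (simp add: W_def power2_eq_square mult_ac)
  \<comment> \<open>The \<open>card K\<close> diagonal pairs contribute at most \<open>X^2\<close>
    each. Averaged over all pairs this is \<open>X^2 / card K\<close>, which is at most
    \<open>E\<close> by the pigeonhole bound on \<open>card K\<close>.\<close>
  have EX: "real (card K) * (real X)\<^sup>2 \<le> (real (card K))\<^sup>2 * E"
  proof -
    have "(real X)\<^sup>2 * real (totient q) \<le> (real X)\<^sup>2 * (real (card K) * 25 ^ (r * g))"
      using cardK by (intro mult_left_mono) auto
    then have "(real X)\<^sup>2 \<le> real (card K) * E"
      using totpos by (simp add: E_def field_simps)
    then have "real (card K) * (real X)\<^sup>2 \<le> real (card K) * (real (card K) * E)"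
      by (rule mult_left_mono) simp
    then show ?thesis by (simp add: power2_eq_square mult.assoc)
  qed
  \<comment> \<open>Were all off-diagonal terms below \<open>W - E\<close>, adding the diagonal
    would give \<open>T < (card K)^2 * W\<close>.\<close>
  have "\<exists>k\<in>K. \<exists>l\<in>K. k \<noteq> l \<and> (norm (\<Sum>n = 1..int X. k n * cnj (l n)))\<^sup>2 \<ge> W - E"
  proof (rule ccontr)
    assume "\<not> ?thesis"
    then have small: "(norm (\<Sum>n = 1..int X. k n * cnj (l n)))\<^sup>2 < W - E"
      if "k \<in> K" "l \<in> K" "k \<noteq> l" for k l
      using that by force
    have "(norm (\<Sum>n = 1..int X. k n * cnj (l n)))\<^sup>2 < (if k = l then (real X)\<^sup>2 else 0) + (W - E)"
      if kl: "k \<in> K" "l \<in> K" for k l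
    proof (cases "k = l")
      case True
      have le1: "norm (k n) \<le> 1" if "k \<in> K" for k n
        using dirichlet_character_norm[OF Kd[OF that], of n] Kd[OF that]
        by (cases "coprime n (int q)") (auto simp: dirichlet_character_def)
      have "norm (\<Sum>n = 1..int X. k n * cnj (l n)) \<le> (\<Sum>n = 1..int X. norm (k n * cnj (l n)))"
        by (rule norm_sum)
      also have "\<dots> \<le> (\<Sum>n = 1..int X. 1)"
        using le1[OF kl(1)] le1[OF kl(2)] by (intro sum_mono) (auto simp: norm_mult intro!: mult_le_one)
      finally have "norm (\<Sum>n = 1..int X. k n * cnj (l n)) \<le> real X" by simp
      then have "(norm (\<Sum>n = 1..int X. k n * cnj (l n)))\<^sup>2 \<le> (real X)\<^sup>2"
        by (intro power_mono) auto
      moreover have "0 < W - E" using pos by (simp add: W_def E_def)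
      ultimately show ?thesis unfolding if_P[OF True] by linarith
    qed (use small kl in auto)
    then have "T < (\<Sum>k\<in>K. \<Sum>l\<in>K. (if k = l then (real X)\<^sup>2 else 0) + (W - E))"
      unfolding T_def using finK Kpos by (intro sum_strict_mono) auto
    also have "\<dots> = real (card K) * (real X)\<^sup>2 + (real (card K))\<^sup>2 * (W - E)"
      using finK by (simp only: sum.distrib sum.delta sum.delta' sum_constant)
        (simp add: power2_eq_square)
    also have "\<dots> \<le> (real (card K))\<^sup>2 * W" using EX by (simp add: right_diff_distrib)
    finally show False using TW by simp
  qed
  then obtain k l where kl: "k \<in> K" "l \<in> K" "k \<noteq> l"
    "(norm (\<Sum>n = 1..int X. k n * cnj (l n)))\<^sup>2 \<ge> W - E" by blast
  show ?thesis
    using dirichlet_character_mult_cnj[OF Kd Kd, OF kl(1,2)]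
      dirichlet_character_mult_cnj_nonprincipal[OF Kd Kd, OF kl(1,2,3)] kl(4)
    unfolding W_def E_def by (intro exI[of _ "\<lambda>n. k n * cnj (l n)"]) auto
qed

section \<open>Choice of parameters\<close>

text \<open>With \<open>s = 1 + \<tau>^2\<close> the left side is
  \<open>\<tau> * (1 + ln s) / s\<close>. The bound \<open>1 + ln s \<le> s\<close> serves for small
  \<open>\<tau>\<close>, the bounds \<open>1 + ln s \<le> 2 * sqrt s\<close> and
  \<open>\<tau> \<le> sqrt s\<close> for large \<open>\<tau>\<close>.\<close>

lemma exponent_le:
  fixes \<tau> :: real
  assumes "\<tau> > 0"
  shows "(1 + ln ((\<tau> + 1 / \<tau>) * \<tau>)) / (\<tau> + 1 / \<tau>) \<le> 2 * min 1 \<tau>"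
proof -
  define s where "s = 1 + \<tau>\<^sup>2"
  have s: "s > 0" "(\<tau> + 1 / \<tau>) * \<tau> = s" "\<tau> + 1 / \<tau> = s / \<tau>"
    using assms by (auto simp: s_def power2_eq_square field_simps add_pos_nonneg)
  have l1: "ln s \<le> s - 1" using ln_le_minus_one[OF s(1)] .
  have "ln s = 2 * ln (sqrt s)" using s by (simp add: ln_sqrt)
  also have "\<dots> \<le> 2 * (sqrt s - 1)" using ln_le_minus_one[of "sqrt s"] s by simp
  finally have l2: "1 + ln s \<le> 2 * sqrt s" by simp
  have "\<tau> * (1 + ln s) \<le> \<tau> * s" using l1 assms by (intro mult_left_mono) auto
  then have "\<tau> * (1 + ln s) / s \<le> \<tau>" using s by (simp add: pos_divide_le_eq)
  then have b1: "\<tau> * (1 + ln s) / s \<le> 2 * \<tau>" using assms by linarith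
  have "\<tau> \<le> sqrt s" using assms by (simp add: s_def real_le_rsqrt)
  then have "\<tau> * (1 + ln s) \<le> sqrt s * (2 * sqrt s)"
    using l2 assms s by (intro mult_mono) (auto simp: s_def)
  also have "\<dots> = 2 * s" using s by simp
  finally have b2: "\<tau> * (1 + ln s) / s \<le> 2" using s by (simp add: field_simps)
  have "(1 + ln s) / (s / \<tau>) = \<tau> * (1 + ln s) / s" by (simp add: mult.commute)
  then show ?thesis using b1 b2 unfolding s(2) unfolding s(3) by linarith
qed

text \<open>\<open>L\<close> stands for \<open>ln q\<close>, and the exponentials with
  \<open>A\<close> are the extreme values of \<open>\<tau>\<close>. Being powers of
  \<open>ln L\<close>, they leave \<open>ln x\<close> of order \<open>sqrt L\<close> up to
  logarithmic factors, well between \<open>ln L\<close> and \<open>L\<close>.\<close>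

lemma eventually_parameters:
  fixes A :: real
  assumes "A > 0"
  shows "\<forall>\<^sub>F L in at_top. 1 \<le> ln L \<and> 25 * ln L \<le> L \<and> 2 * L + 1 \<le> exp (L / 5) \<and>
     exp (A * ln (ln L)) * sqrt (L * ln L) \<le> L / 5 \<and>
     exp (- (A * ln (ln L))) * sqrt (L * ln L) \<ge> 2 * ln (24 * L\<^sup>2) \<and>
     exp (- (A * ln (ln L))) * sqrt (L / ln L) \<ge> 1200 * ln (16 * L)"
  using assms by (intro eventually_conj; real_asymp)

lemma disjoint_subfamily_of_card:
  assumes "finite S" "r * g \<le> card S"
  shows "\<exists>G :: nat \<Rightarrow> 'a set. (\<forall>i<r. G i \<subseteq> S \<and> card (G i) = g) \<and> disjoint_family_on G {..<r}"
  using assms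
proof (induction r arbitrary: S)
  case (Suc r)
  obtain H where H: "H \<subseteq> S" "card H = g"
    using obtain_subset_with_card_n[of g S] Suc.prems by auto
  have "card (S - H) = card S - g"
    using H Suc.prems finite_subset by (metis card_Diff_subset)
  moreover have "r * g \<le> card S - g" using Suc.prems(2) unfolding mult_Suc by linarith
  ultimately obtain G where G: "\<And>i. i < r \<Longrightarrow> G i \<subseteq> S - H \<and> card (G i) = g" "disjoint_family_on G {..<r}"
    using Suc.IH[of "S - H"] Suc.prems by auto
  have "disjoint_family_on (G(r := H)) {..<Suc r}"
    using G unfolding disjoint_family_on_def by (fastforce simp: less_Suc_eq)
  moreover have "\<forall>i<Suc r. (G(r := H)) i \<subseteq> S \<and> card ((G(r := H)) i) = g"
    using G(1) H by (auto simp: less_Suc_eq)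
  ultimately show ?case by blast
qed (auto simp: disjoint_family_on_def)

lemma nonprincipal_character_sum_ge_exp:
  fixes q :: nat and x \<tau> L l :: real
  assumes L: "L = ln (real q)" "l = ln L"
    and l: "1 \<le> l" "25 * l \<le> L" "2 * L + 1 \<le> exp (L / 5)"
    and x: "x > 0" "\<tau> > 0" "ln x = \<tau> * sqrt (L * l)" "ln x \<le> L / 5" "ln x \<ge> 2 * ln (24 * L\<^sup>2)"
    and m: "min 1 \<tau> * sqrt (L / l) \<ge> 1200 * ln (16 * L)"
  shows "\<exists>\<chi>. dirichlet_character q \<chi> \<and> \<chi> \<noteq> principal_character q \<and>
    norm (\<Sum>n = 1..\<lfloor>x\<rfloor>. \<chi> n) / sqrt x \<ge> exp (min 1 \<tau> * sqrt (L / l) / 2400)"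
proof -
  \<comment> \<open>With \<open>g\<close> close to \<open>4 sqrt y\<close> the gain \<open>(3 g / 4)\<^sup>2\<close> of each prime factor beats its cost \<open>y\<close>
    by a factor \<open>9\<close>, while \<open>r g \<le> L / 25\<close> keeps the number \<open>25 ^ (r g)\<close> of cells in the
    pigeonhole step below \<open>q powr (1 / 5)\<close>.\<close>
  define R where "R = min 1 \<tau> * sqrt (L / l)"
  define y where "y = 25 * (L * l)"
  define g where "g = nat \<lceil>20 * sqrt (L * l)\<rceil>"
  define r where "r = nat \<lfloor>R / 600\<rfloor>"
  have L25: "L \<ge> 25" using l by simp
  have q: "real q = exp L" "q > 0"
  proof -
    have "q \<noteq> 0" using L L25 by (cases "q = 0") auto
    then show "real q = exp L" "q > 0" using L by auto
  qed
  have Ll: "L * l \<ge> 25" using mult_mono[of 25 L 1 l] L25 l by simp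
  have sqrtLl: "sqrt (L * l) \<ge> 5" using Ll by (simp add: real_le_rsqrt)
  have sqmul: "sqrt (L / l) * sqrt (L * l) = L"
    using L25 l by (simp flip: real_sqrt_mult)
  have lsq: "l * sqrt (L / l) = sqrt (L * l)"
  proof -
    have "sqrt (l\<^sup>2) = l" using l by simp
    then have "l * sqrt (L / l) = sqrt (l\<^sup>2 * (L / l))" by (simp only: real_sqrt_mult)
    also have "l\<^sup>2 * (L / l) = L * l" using l by (simp add: power2_eq_square)
    finally show ?thesis .
  qed
  have R0: "R \<ge> 0" using x L25 l by (simp add: R_def)
  have ln16L: "ln (16 * L) \<ge> 1" using L25 exp_le by (subst ln_ge_iff) auto
  have r: "real r \<le> R / 600" "real r > R / 600 - 1"
    unfolding r_def using R0 by linarith+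
  \<comment> \<open>Since \<open>R \<ge> 1200 * ln (16 * L) \<ge> 1200\<close>, the floor costs at
    most half of \<open>R / 600\<close>.\<close>
  have r_big: "real r \<ge> R / 1200" "real r \<ge> ln (16 * L)"
    using r m ln16L unfolding R_def[symmetric] by linarith+
  have g1: "real g \<ge> 20 * sqrt (L * l)" "real g \<le> 21 * sqrt (L * l)" "g > 0"
  proof -
    show "real g \<ge> 20 * sqrt (L * l)" unfolding g_def by linarith
    show "real g \<le> 21 * sqrt (L * l)" unfolding g_def using sqrtLl by linarith
    show "g > 0" using sqrtLl \<open>real g \<ge> 20 * sqrt (L * l)\<close> by (cases "g = 0") auto
  qed
  have rg: "real (r * g) \<le> L / 25"
  proof -
    have "R \<le> sqrt (L / l)" using L25 l unfolding R_def by (intro mult_left_le_one_le) (use x in auto)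
    then have "real r * real g \<le> (sqrt (L / l) / 600) * (21 * sqrt (L * l))"
      using r(1) g1 L25 l by (intro mult_mono) auto
    also have "\<dots> = 21 / 600 * L" using sqmul by (simp add: mult_ac)
    finally show ?thesis using L25 by simp
  qed
  have y8: "y \<ge> 8" using Ll by (simp add: y_def)
  have lny: "ln y \<le> 2 * l"
  proof -
    have "y \<le> L * L" using l L25 by (simp add: y_def)
    then have "ln y \<le> ln (L * L)" using y8 L25 by (subst ln_le_cancel_iff) auto
    also have "\<dots> = 2 * l" using L L25 by (simp add: ln_mult)
    finally show ?thesis .
  qed
  have omega: "real (card (prime_factors q)) \<le> 2 * L"
    using card_prime_factors_le_ln[OF q(2)] L by simp
  define Q where "Q = {p::nat. prime p \<and> real p \<le> y}"
  define S where "S = Q - prime_factors q"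
  have finQ: "finite {p::nat. prime p \<and> real p \<le> t}" for t
    by (rule finite_subset[of _ "{..nat \<lfloor>t\<rfloor>}"]) (auto simp: le_nat_floor)
  have finS: "finite S" using finQ by (simp add: S_def Q_def)
  \<comment> \<open>Of at least \<open>25 / 8 * L\<close> primes up to \<open>y\<close>, at most
    \<open>2 * L\<close> divide \<open>q\<close>.\<close>
  have "real (card S) \<ge> L"
  proof -
    have "25 / 8 * L = y / (4 * (2 * l))" using l by (simp add: y_def)
    also have "\<dots> \<le> y / (4 * ln y)"
      using lny y8 l by (intro divide_left_mono mult_left_mono) auto
    also have "\<dots> \<le> real (card Q)" unfolding Q_def by (rule prime_count_lower_bound[OF y8])
    finally have "25 / 8 * L \<le> real (card Q)" .
    moreover have "card Q \<le> card S + card (prime_factors q)"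
      unfolding S_def using diff_card_le_card_Diff[of "prime_factors q" Q] by simp
    ultimately show ?thesis using omega L25 by linarith
  qed
  then have "real (r * g) \<le> real (card S)" using rg L25 by linarith
  then have "r * g \<le> card S" by (simp only: of_nat_le_iff)
  then obtain G where G: "\<And>i. i < r \<Longrightarrow> G i \<subseteq> S \<and> card (G i) = g" "disjoint_family_on G {..<r}"
    using disjoint_subfamily_of_card[OF finS] by blast
  \<comment> \<open>This is the room left for \<open>b\<close> once \<open>r\<close> primes up to
    \<open>y\<close> are chosen. They use up at most \<open>ln x / 300\<close> of
    \<open>ln x\<close>.\<close>
  define Z where "Z = x / y ^ r"
  have yr: "y ^ r > 0" using y8 by simp
  have lnZ: "ln Z \<ge> ln x / 2" "ln Z \<le> ln x"
  proof -
    have e: "ln Z = ln x - real r * ln y"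
      unfolding Z_def using x yr y8 by (simp add: ln_div ln_realpow)
    have "real r * ln y \<le> (\<tau> * sqrt (L / l) / 600) * (2 * l)"
    proof (intro mult_mono lny)
      have "R \<le> \<tau> * sqrt (L / l)" using L25 l unfolding R_def by (intro mult_right_mono) auto
      then show "real r \<le> \<tau> * sqrt (L / l) / 600" using r(1) by linarith
    qed (use x y8 L25 l in auto)
    also have "\<dots> = ln x / 300" using lsq x(3) by (simp add: mult_ac)
    finally have "real r * ln y \<le> ln x / 300" .
    moreover have "ln x \<ge> 0" using x Ll by simp
    ultimately show "ln Z \<ge> ln x / 2" using e by linarith
    show "ln Z \<le> ln x" using e y8 by simp
  qed
  have Zpos: "Z > 0" using x yr by (simp add: Z_def)
  have Zge: "Z \<ge> 24 * L\<^sup>2"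
  proof -
    have "ln (24 * L\<^sup>2) \<le> ln Z" using lnZ(1) x(5) by linarith
    then show ?thesis using Zpos L25 by (subst (asm) ln_le_cancel_iff) auto
  qed
  have "24 * L\<^sup>2 \<ge> 24 * 25" using L25 mult_mono[of 25 L 1 L] by (simp add: power2_eq_square)
  then have Z8: "Z \<ge> 8" using Zge by linarith
  \<comment> \<open>Taking only primes for \<open>b\<close> makes the coprimality conditions
    immediate. The resulting loss of a factor \<open>8 * L\<close> is recovered later from
    \<open>r \<ge> ln (16 * L)\<close>.\<close>
  define B where "B = {p::nat. prime p \<and> real p \<le> Z} - prime_factors q - (\<Union>i<r. G i)"
  have finG: "finite (G i)" if "i < r" for i using G(1)[OF that] finS finite_subset by blast
  have cardB: "real (card B) \<ge> Z / (8 * L)"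
  proof -
    have "Z / (4 * L) \<le> Z / (4 * ln Z)"
      using lnZ(2) x(4) L25 Z8 by (intro divide_left_mono mult_left_mono) auto
    also have "\<dots> \<le> real (card {p::nat. prime p \<and> real p \<le> Z})"
      by (rule prime_count_lower_bound[OF Z8])
    finally have 1: "Z / (4 * L) \<le> real (card {p::nat. prime p \<and> real p \<le> Z})" .
    have "card (\<Union>i<r. G i) \<le> (\<Sum>i<r. card (G i))" by (rule card_UN_le) simp
    then have 2: "card (\<Union>i<r. G i) \<le> r * g" using G(1) by simp
    have 3: "card {p::nat. prime p \<and> real p \<le> Z} \<le>
        card B + card (\<Union>i<r. G i) + card (prime_factors q)"
      unfolding B_def
      using diff_card_le_card_Diff[of "prime_factors q" "{p::nat. prime p \<and> real p \<le> Z}"]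
        diff_card_le_card_Diff[of "\<Union>i<r. G i" "{p::nat. prime p \<and> real p \<le> Z} - prime_factors q"]
        finG by simp
    have "Z / (4 * L) \<le> real (card B) + real (r * g) + 2 * L"
      using 1 2 3 omega by linarith
    then have "Z / (4 * L) - 3 * L \<le> real (card B)" using rg L25 by linarith
    moreover have "3 * L \<le> Z / (8 * L)"
      using Zge L25 by (simp add: pos_le_divide_eq power2_eq_square)
    moreover have "Z / (4 * L) = Z / (8 * L) + Z / (8 * L)" using L25 by (simp add: field_simps)
    ultimately show ?thesis by linarith
  qed
  define X where "X = nat \<lfloor>x\<rfloor>"
  have X: "int X = \<lfloor>x\<rfloor>" "real X \<le> x" using x by (auto simp: X_def)
  define W where "W = real (card B) * (3 / 4 * real g) ^ (2 * r)"
  define E where "E = (real X)\<^sup>2 * 25 ^ (r * g) / real (totient q)"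
  have W_ge: "W \<ge> x * (9 ^ r / (8 * L))"
  proof -
    have "9 * y = (3 / 4 * (20 * sqrt (L * l)))\<^sup>2"
      using L25 l by (simp add: y_def power_mult_distrib)
    also have "\<dots> \<le> (3 / 4 * real g)\<^sup>2"
      using g1 Ll by (intro power_mono) auto
    finally have "(9 * y) ^ r \<le> ((3 / 4 * real g)\<^sup>2) ^ r" using y8 by (intro power_mono) auto
    then have "(9 * y) ^ r \<le> (3 / 4 * real g) ^ (2 * r)" by (simp only: power_mult)
    then have "Z / (8 * L) * (9 * y) ^ r \<le> W"
      unfolding W_def using cardB Zpos L25 y8 by (intro mult_mono) auto
    also have "Z / (8 * L) * (9 * y) ^ r = x * (9 ^ r / (8 * L))"
      unfolding Z_def using y8 by (simp add: power_mult_distrib)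
    finally show ?thesis .
  qed
  \<comment> \<open>In powers of \<open>q\<close>: \<open>x\<close> and the number of cells are each
    at most \<open>q powr (1 / 5)\<close>, while the totient is at least
    \<open>q powr (4 / 5)\<close>.\<close>
  have E_le: "E \<le> x"
  proof -
    have "exp 1 \<ge> (2::real)" using exp_ge_add_one_self[of 1] by simp
    then have "exp 1 ^ 5 \<ge> (2::real) ^ 5" by (intro power_mono) auto
    then have "(25::real) \<le> exp 5" by (simp flip: exp_of_nat_mult)
    then have "(25::real) ^ (r * g) \<le> exp 5 ^ (r * g)" by (intro power_mono) auto
    also have "\<dots> = exp (real (r * g) * 5)" by (simp only: exp_of_nat_mult)
    also have "\<dots> \<le> exp (L / 5)" using rg by simp
    finally have p25: "(25::real) ^ (r * g) \<le> exp (L / 5)" .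
    have xe: "x \<le> exp (L / 5)" using iffD2[OF exp_le_cancel_iff x(4)] x(1) by simp
    have "exp L / (2 * L + 1) \<le> real (totient q)"
      using totient_lower_bound[OF q(2)] unfolding q(1) by simp
    then have "exp L \<le> real (totient q) * (2 * L + 1)" using L25 by (simp add: pos_divide_le_eq)
    also have "\<dots> \<le> real (totient q) * exp (L / 5)" using l by (intro mult_left_mono) auto
    finally have "exp L / exp (L / 5) \<le> real (totient q)" by (simp add: pos_divide_le_eq)
    then have tot: "exp (L - L / 5) \<le> real (totient q)" by (simp only: exp_diff)
    have "(real X)\<^sup>2 * 25 ^ (r * g) \<le> x\<^sup>2 * exp (L / 5)"
      using X p25 by (intro mult_mono power_mono) auto
    also have "\<dots> \<le> (x * exp (L / 5)) * exp (L / 5)"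
      using xe x by (simp add: power2_eq_square)
    also have "\<dots> = x * exp (2 / 5 * L)" by (simp add: mult.assoc flip: exp_add)
    also have "\<dots> \<le> x * exp (L - L / 5)" using x L25 by (intro mult_left_mono) auto
    also have "\<dots> \<le> x * real (totient q)" using tot x by (intro mult_left_mono) auto
    finally show ?thesis unfolding E_def using q(2) by (simp add: pos_divide_le_eq)
  qed
  \<comment> \<open>From \<open>9 > e^2\<close> one gets \<open>9 ^ r \<ge> 16 * L * exp r\<close>,
    so the lower bound for \<open>W / x\<close> is at least
    \<open>2 * exp r \<ge> exp r + 1\<close>; the extra 1 pays for \<open>E \<le> x\<close>.\<close>
  have main: "W - E \<ge> x * exp (real r)" 
  proof -
    have "exp (real r) \<ge> exp (ln (16 * L))" using r_big by simp
    then have er: "exp (real r) \<ge> 16 * L" using L25 by simp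
    have "exp (real r) = exp 1 ^ r" by (simp flip: exp_of_nat_mult)
    also have "\<dots> \<le> 3 ^ r" using exp_le by (intro power_mono) auto
    finally have "exp (real r) * exp (real r) \<le> 3 ^ r * 3 ^ r" by (intro mult_mono) auto
    also have "\<dots> = 9 ^ r" by (simp flip: power_mult_distrib)
    finally have "16 * L * exp (real r) \<le> 9 ^ r"
      using mult_right_mono[OF er exp_ge_zero, of "real r"] by linarith
    then have "2 * exp (real r) \<le> 9 ^ r / (8 * L)" using L25 by (simp add: pos_le_divide_eq mult_ac)
    then have "exp (real r) + 1 \<le> 9 ^ r / (8 * L)" using er L25 by linarith
    then have "x * (exp (real r) + 1) \<le> x * (9 ^ r / (8 * L))" using x by (intro mult_left_mono) auto
    then show ?thesis using W_ge E_le by (simp add: distrib_left)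
  qed
  have "\<exists>\<chi>. dirichlet_character q \<chi> \<and> \<chi> \<noteq> principal_character q \<and>
    (norm (\<Sum>n = 1..int X. \<chi> n))\<^sup>2 \<ge> W - E"
    unfolding W_def E_def
  proof (rule nonprincipal_character_sum_lower_bound[OF q(2) g1(3), where G = G and B = B])
    show "card (G i) = g" if "i < r" for i using G(1) that by blast
    show "prime p \<and> coprime p q" if "i < r" "p \<in> G i" for i p
      using G(1)[OF that(1)] that(2) q(2)
      by (auto simp: S_def Q_def in_prime_factors_iff intro!: prime_imp_coprime)
    show "disjoint_family_on G {..<r}" by (rule G(2))
    show "finite B" unfolding B_def using finQ by blast
    show "b > 0 \<and> coprime b q" if "b \<in> B" for b
      using that q(2) by (auto simp: B_def in_prime_factors_iff prime_gt_0_nat intro!: prime_imp_coprime)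
    show "\<not> p dvd b" if "b \<in> B" "i < r" "p \<in> G i" for b i p
      using that G(1)[OF that(2)] primes_dvd_imp_eq[of p b] by (auto simp: B_def S_def Q_def)
    show "b * (\<Prod>i<r. s i) \<le> X" if "b \<in> B" "s \<in> PiE {..<r} G" for b s
    proof -
      have "real (\<Prod>i<r. s i) = (\<Prod>i<r. real (s i))" by simp
      also have "\<dots> \<le> (\<Prod>i<r. y)"
      proof (intro prod_mono conjI)
        fix i assume "i \<in> {..<r}"
        then show "real (s i) \<le> y" using that(2) G(1)[of i] by (auto simp: S_def Q_def)
      qed auto
      finally have "real (\<Prod>i<r. s i) \<le> y ^ r" by simp
      moreover have "real b \<le> Z" using that by (simp add: B_def)
      ultimately have "real b * real (\<Prod>i<r. s i) \<le> Z * y ^ r"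
        using Zpos by (intro mult_mono) (simp_all add: prod_nonneg)
      also have "Z * y ^ r = x" using y8 by (simp add: Z_def)
      finally have "real (b * (\<Prod>i<r. s i)) \<le> x" by simp
      then show ?thesis unfolding X_def by (rule le_nat_floor)
    qed
    have "x * exp (real r) > 0" using x by simp
    then show "(real X)\<^sup>2 * 25 ^ (r * g) / real (totient q) < real (card B) * (3 / 4 * real g) ^ (2 * r)"
      using main unfolding W_def E_def by linarith
  qed
  then obtain \<chi> where \<chi>: "dirichlet_character q \<chi>" "\<chi> \<noteq> principal_character q"
    "(norm (\<Sum>n = 1..\<lfloor>x\<rfloor>. \<chi> n))\<^sup>2 \<ge> W - E" using X(1) by metis
  \<comment> \<open>The bound is for the squared norm, so the exponent
    \<open>R / 1200 \<le> r\<close> is halved.\<close>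
  have "(sqrt x * exp (R / 2400))\<^sup>2 \<le> x * exp (real r)"
  proof -
    have "(sqrt x * exp (R / 2400))\<^sup>2 = x * exp (R / 1200)"
      using x by (simp add: power_mult_distrib flip: exp_double)
    then show ?thesis using r_big x by simp
  qed
  then have "(sqrt x * exp (R / 2400))\<^sup>2 \<le> (norm (\<Sum>n = 1..\<lfloor>x\<rfloor>. \<chi> n))\<^sup>2"
    using main \<chi>(3) by linarith
  then have "sqrt x * exp (R / 2400) \<le> norm (\<Sum>n = 1..\<lfloor>x\<rfloor>. \<chi> n)"
    by (rule power2_le_imp_le) simp
  then have "exp (R / 2400) \<le> norm (\<Sum>n = 1..\<lfloor>x\<rfloor>. \<chi> n) / sqrt x"
    using x by (simp add: pos_le_divide_eq mult.commute)
  then show ?thesis using \<chi> unfolding R_def by blast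
qed

section \<open>Conclusion, uniformly in \<open>x\<close> and \<open>\<tau>\<close>\<close>

theorem theorem5:
  "\<exists>c::real. c > 0 \<and> (\<exists>C::real. C > 0 \<and>
     (\<forall>A::real. A > 0 \<longrightarrow>
       (\<forall>\<^sub>F q::nat in at_top.
         \<forall>(x::real) (\<tau>::real).
           x > 0 \<longrightarrow> \<tau> > 0 \<longrightarrow>
           ln x = \<tau> * sqrt (ln (real q) * ln (ln (real q))) \<longrightarrow>
           \<bar>ln \<tau>\<bar> \<le> A * ln (ln (ln (real q))) \<longrightarrow>
           (let \<eta> = \<tau> + 1 / \<tau> in
             \<exists>\<chi>. dirichlet_character q \<chi> \<and> \<chi> \<noteq> principal_character q \<and>
               1 / sqrt x * norm (\<Sum>n = 1..\<lfloor>x\<rfloor>. \<chi> n) \<ge>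
                 C * exp (c * ((1 + ln (\<eta> * \<tau>)) / \<eta>)
                            * sqrt (ln (real q) / ln (ln (real q))))))))"
proof (rule exI[of _ "1 / 4800"], intro conjI, simp, rule exI[of _ 1], intro conjI, simp, intro allI impI)
  fix A :: real assume A: "A > 0"
  \<comment> \<open>The threshold for \<open>q\<close> obtained here depends on \<open>A\<close>
    alone, hence is uniform in \<open>x\<close> and \<open>\<tau>\<close>.\<close>
  have "filterlim (\<lambda>q::nat. ln (real q)) at_top at_top" by real_asymp
  from eventually_compose_filterlim[OF eventually_parameters[OF A] this]
  show "\<forall>\<^sub>F q::nat in at_top.
         \<forall>(x::real) (\<tau>::real).
           x > 0 \<longrightarrow> \<tau> > 0 \<longrightarrow>
           ln x = \<tau> * sqrt (ln (real q) * ln (ln (real q))) \<longrightarrow>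
           \<bar>ln \<tau>\<bar> \<le> A * ln (ln (ln (real q))) \<longrightarrow>
           (let \<eta> = \<tau> + 1 / \<tau> in
             \<exists>\<chi>. dirichlet_character q \<chi> \<and> \<chi> \<noteq> principal_character q \<and>
               1 / sqrt x * norm (\<Sum>n = 1..\<lfloor>x\<rfloor>. \<chi> n) \<ge>
                 1 * exp (1 / 4800 * ((1 + ln (\<eta> * \<tau>)) / \<eta>)
                            * sqrt (ln (real q) / ln (ln (real q)))))"
  proof eventually_elim
    case (elim q)
    define L where "L = ln (real q)"
    define l where "l = ln L"
    have par: "1 \<le> l" "25 * l \<le> L" "2 * L + 1 \<le> exp (L / 5)"
      "exp (A * ln l) * sqrt (L * l) \<le> L / 5"
      "exp (- (A * ln l)) * sqrt (L * l) \<ge> 2 * ln (24 * L\<^sup>2)"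
      "exp (- (A * ln l)) * sqrt (L / l) \<ge> 1200 * ln (16 * L)"
      using elim unfolding L_def l_def by auto
    show ?case
      unfolding Let_def L_def[symmetric] l_def[symmetric]
    proof (intro allI impI)
      fix x \<tau> :: real
      assume x: "x > 0" "\<tau> > 0" "ln x = \<tau> * sqrt (L * l)" "\<bar>ln \<tau>\<bar> \<le> A * ln l"
      have "exp (ln \<tau>) \<le> exp (A * ln l)" "exp (- (A * ln l)) \<le> exp (ln \<tau>)"
        using x(4) by auto
      then have \<tau>: "\<tau> \<le> exp (A * ln l)" "exp (- (A * ln l)) \<le> \<tau>" using x by auto
      have "exp (- (A * ln l)) \<le> 1" using A par(1) by simp
      then have \<tau>1: "exp (- (A * ln l)) \<le> min 1 \<tau>" using \<tau> by simp
      have L0: "L > 0" using par by linarith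
      have "ln x \<le> exp (A * ln l) * sqrt (L * l)"
        unfolding x(3) using \<tau> par L0 by (intro mult_right_mono) auto
      moreover have "ln x \<ge> exp (- (A * ln l)) * sqrt (L * l)"
        unfolding x(3) using \<tau> par L0 by (intro mult_right_mono) auto
      moreover have "min 1 \<tau> * sqrt (L / l) \<ge> exp (- (A * ln l)) * sqrt (L / l)"
        using \<tau>1 par L0 by (intro mult_right_mono) auto
      ultimately obtain \<chi> where \<chi>: "dirichlet_character q \<chi>" "\<chi> \<noteq> principal_character q"
        "norm (\<Sum>n = 1..\<lfloor>x\<rfloor>. \<chi> n) / sqrt x \<ge> exp (min 1 \<tau> * sqrt (L / l) / 2400)"
        using nonprincipal_character_sum_ge_exp[OF L_def l_def par(1-3) x(1-3)] par(4-6)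
        by (meson order_trans)
      \<comment> \<open>The constant is half of \<open>1 / 2400\<close>, to offset the factor 2 in
        \<open>exponent_le\<close>.\<close>
      have "1 / 4800 * ((1 + ln ((\<tau> + 1 / \<tau>) * \<tau>)) / (\<tau> + 1 / \<tau>)) \<le> 1 / 4800 * (2 * min 1 \<tau>)"
        using exponent_le[OF x(2)] by (intro mult_left_mono) auto
      then have "1 / 4800 * ((1 + ln ((\<tau> + 1 / \<tau>) * \<tau>)) / (\<tau> + 1 / \<tau>)) * sqrt (L / l)
          \<le> 1 / 4800 * (2 * min 1 \<tau>) * sqrt (L / l)"
        using par L0 by (intro mult_right_mono) auto
      also have "\<dots> = min 1 \<tau> * sqrt (L / l) / 2400" by simp
      finally have "exp (1 / 4800 * ((1 + ln ((\<tau> + 1 / \<tau>) * \<tau>)) / (\<tau> + 1 / \<tau>)) * sqrt (L / l))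
          \<le> norm (\<Sum>n = 1..\<lfloor>x\<rfloor>. \<chi> n) / sqrt x"
        using \<chi>(3) by (meson exp_le_cancel_iff order_trans)
      then show "\<exists>\<chi>. dirichlet_character q \<chi> \<and> \<chi> \<noteq> principal_character q \<and>
          1 / sqrt x * norm (\<Sum>n = 1..\<lfloor>x\<rfloor>. \<chi> n) \<ge>
            1 * exp (1 / 4800 * ((1 + ln ((\<tau> + 1 / \<tau>) * \<tau>)) / (\<tau> + 1 / \<tau>)) * sqrt (L / l))"
        using \<chi>(1,2) by (intro exI[of _ \<chi>]) simp
    qed
  qed
qed

end
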